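(* Let $\phi_T$ and $\phi_S$ be the two target functions defined in the context, and let $\Phi_T=\{\phi_T\}$ and $\Phi_S=\{\phi_S\}$; here $\alpha(\Phi_T)=\alpha(\Phi_S)=\alpha(\Phi_T\cup\Phi_S)=1$. Both $\Phi_T$ and $\Phi_S$ are compatible with respect to the fault-tolerant $(n,1)$-convergence problem to a point (FC(1)-PO). However, $\Phi=\Phi_T\cup\Phi_S$ is not.
   Context: Robot model. Robots $r_1,\dots,r_n$ are points in the plane $\mathbb{R}^2$, which carries a fixed right-handed global coordinate system $Z_0$. Time is discrete, $t=0,1,2,\dots$; $\mathbf{x}_t(r_i)$ is the position of $r_i$ at time $t$ in $Z_0$, and the configuration at $t$ is the multiset $P_t=\{\mathbf{x}_t(r_i):1\le i\le n\}$. Robot $r_i$ has a local coordinate system $Z_i$, right-handed, with its own unit length and axis directions (arbitrary, fixed over time), whose origin is always the current position of $r_i$; $\gamma_i$ denotes the coordinate transformation from $Z_i$ to $Z_0$ (an orientation-preserving similarity with $\gamma_i((0,0))=\mathbf{x}_t(r_i)$ at time $t$). A target function $\phi$ assigns to every multiset $P$ of $n$ points of $\mathbb{R}^2$ (for every $n\ge1$) an element of $\mathbb{R}^2\cup\{\bot\}$, with $\phi(P)=\bot$ if and only if $(0,0)\notin P$. Each robot $r_i$ is assigned a target function $\phi_i$. The scheduler is semi-synchronous: at each time $t$ an arbitrary subset of robots is activated; if a non-crashed $r_i$ is activated at $t$ then $\mathbf{x}_{t+1}(r_i)=\gamma_i(\phi_i(\gamma_i^{-1}(P_t)))$, otherwise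 $\mathbf{x}_{t+1}(r_i)=\mathbf{x}_t(r_i)$. The schedule is fair: every robot is activated infinitely often. A faulty robot may crash at an arbitrary time, after which it never moves again; crashed robots cannot be distinguished from other robots. The sequence $P_0,P_1,\dots$ is an execution. Scale. $CH(P)$ is the convex hull of $P$, $g(P)$ is the center of gravity of $P$ (with multiplicity), and $d*CH(P)=\{d\mathbf{x}+(1-d)g(P):\mathbf{x}\in CH(P)\}$ for $d\ge0$. $\alpha(\phi,P)$ is the smallest $d\ge 0$ with $\phi(P)\in d*CH(P)$ (and $0$ if $\phi(P)=\bot$; $\infty$ if there is no such $d$). $\alpha(\phi)=\sup_P\alpha(\phi,P)$ and $\alpha(\Phi)=\sup_{\phi\in\Phi}\alpha(\phi)$. Compatibility. A set $\Phi$ of target functions is compatible with respect to FC(1)-PO if, for every number $n\ge2$ of robots, every assignment of target functions from $\Phi$ to the robots (different robots may get different ones), every choice of local coordinate systems, every initial configuration, every fair schedule and every pattern of crashes in which at most one robot is faulty (possibly none), all robots (including a faulty one) converge to one common point as $t\to\infty$. Target functions. Condition $\Psi$ on a multiset $P$: $|P|=7$, $(0,0)\in P$, $P=T\cup S$ where $T$ is the vertex set of an equilateral triangle and $S$ is the vertex set of a square, $T$ and $S$ have the same side length, and the triangle and the square do not overlap each other (the closed regions are disjoint). For $P$ with $(0,0)\in P$: - $\phi_T(P)=g(T)/2$ if $P$ satisfies $\Psi$ and $(0,0)\in T$; $\phi_T(P)=g(P)$ in all other cases. - $\phi_S(P)=g(S)/2$ if $P$ satisfies $\Psi$ and $(0,0)\in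 S$; $\phi_S(P)=g(P)$ in all other cases. *)

theory Defs
  imports "HOL-Analysis.Analysis" "HOL-Library.Multiset"
begin

(* The plane is modelled by the type complex, (0,0) being 0.  The undefined value of a
   target function is None.  Restrictions on the size of a multiset (at least one point) are
   imposed where target functions are used. *)

type_synonym target_fun = "complex multiset \<Rightarrow> complex option"

definition target_function :: "target_fun \<Rightarrow> bool" where
  "target_function \<phi> \<longleftrightarrow> (\<forall>P. P \<noteq> {#} \<longrightarrow> (\<phi> P = None \<longleftrightarrow> 0 \<notin># P))"

definition gravity_center :: "complex multiset \<Rightarrow> complex" where
  "gravity_center P = sum_mset P / of_nat (size P)"

definition scaled_hull :: "real \<Rightarrow> complex multiset \<Rightarrow> complex set" where
  "scaled_hull d P =
     (\<lambda>x. d *\<^sub>R x + (1 - d) *\<^sub>R gravity_center P) ` (convex hull (set_mset P))"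

definition alpha_at :: "target_fun \<Rightarrow> complex multiset \<Rightarrow> ennreal" where
  "alpha_at \<phi> P =
     (case \<phi> P of
        None \<Rightarrow> 0
      | Some y \<Rightarrow>
          if \<exists>d\<ge>0. y \<in> scaled_hull d P
          then ennreal (LEAST d. 0 \<le> d \<and> y \<in> scaled_hull d P)
          else \<infinity>)"

(* The LEAST above is a genuine minimum. *)
lemma scaled_hull_least_exists:
  assumes "0 \<le> d0" "y \<in> scaled_hull d0 P"
  shows "\<exists>d. 0 \<le> d \<and> y \<in> scaled_hull d P \<and> (\<forall>e. 0 \<le> e \<and> y \<in> scaled_hull e P \<longrightarrow> d \<le> e)"
proof -
  let ?K = "convex hull (set_mset P)"
  let ?g = "gravity_center P"
  define A where "A = ({0..d0} \<times> ?K) \<inter> {p. fst p *\<^sub>R snd p + (1 - fst p) *\<^sub>R ?g = y}"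
  have "compact ?K"
    by (simp add: finite_imp_compact_convex_hull)
  moreover have "closed {p::real \<times> complex. fst p *\<^sub>R snd p + (1 - fst p) *\<^sub>R ?g = y}"
    by (intro closed_Collect_eq continuous_intros)
  ultimately have "compact A"
    unfolding A_def by (intro compact_Int_closed compact_Times) auto
  then have "compact (fst ` A)"
    by (intro compact_continuous_image continuous_intros)
  moreover have memA: "e \<in> fst ` A \<longleftrightarrow> 0 \<le> e \<and> e \<le> d0 \<and> y \<in> scaled_hull e P" for e
    by (force simp: A_def scaled_hull_def)
  moreover have "fst ` A \<noteq> {}"
    using assms memA by blast
  ultimately obtain d where d: "d \<in> fst ` A" "\<forall>e\<in>fst ` A. d \<le> e"
    using compact_attains_inf by blast
  then have "d \<le> e" if "0 \<le> e" "y \<in> scaled_hull e P" for e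
    using that memA[of e] memA[of d] by (cases "e \<le> d0") (blast, force)
  then show ?thesis
    using d memA by blast
qed

definition alpha :: "target_fun \<Rightarrow> ennreal" where
  "alpha \<phi> = (SUP P\<in>{P. P \<noteq> {#}}. alpha_at \<phi> P)"

definition alpha_set :: "target_fun set \<Rightarrow> ennreal" where
  "alpha_set \<Phi> = (SUP \<phi>\<in>\<Phi>. alpha \<phi>)"

(* u is the linear part of the coordinate transformation of a robot: the orientation-preserving
   similarities of the plane are the maps z |-> p + u * z with u nonzero.  The modulus of u is
   the local unit length and its argument the direction of the local x-axis; p is the current
   position of the robot. *)
definition to_global :: "complex \<Rightarrow> complex \<Rightarrow> complex \<Rightarrow> complex" where
  "to_global u p z = p + u * z"

definition configuration :: "nat \<Rightarrow> (nat \<Rightarrow> complex) \<Rightarrow> complex multiset" where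
  "configuration n x = image_mset x (mset_set {..<n})"

(* The argument of the target function always contains 0, the image of the robot's own position,
   so its value is not None. *)
definition move_result :: "target_fun \<Rightarrow> complex \<Rightarrow> complex \<Rightarrow> complex multiset \<Rightarrow> complex" where
  "move_result \<phi> u p P =
     to_global u p (the (\<phi> (image_mset (inv (to_global u p)) P)))"

(* Robots are 0, ..., n - 1.  act t is the set of robots activated at time t; robot i crashes
   at time crash i, with infinity meaning that it is not faulty. *)
definition execution ::
  "nat \<Rightarrow> (nat \<Rightarrow> target_fun) \<Rightarrow> (nat \<Rightarrow> complex) \<Rightarrow> (nat \<Rightarrow> nat set) \<Rightarrow> (nat \<Rightarrow> enat)
    \<Rightarrow> (nat \<Rightarrow> nat \<Rightarrow> complex) \<Rightarrow> bool" where
  "execution n \<phi> u act crash x \<longleftrightarrow>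
     (\<forall>t. \<forall>i<n. x (Suc t) i =
        (if i \<in> act t \<and> enat t < crash i
         then move_result (\<phi> i) (u i) (x t i) (configuration n (x t))
         else x t i))"

definition fair :: "nat \<Rightarrow> (nat \<Rightarrow> nat set) \<Rightarrow> bool" where
  "fair n act \<longleftrightarrow> (\<forall>i<n. infinite {t. i \<in> act t})"

definition faulty :: "nat \<Rightarrow> (nat \<Rightarrow> enat) \<Rightarrow> nat set" where
  "faulty n crash = {i. i < n \<and> crash i \<noteq> \<infinity>}"

definition compatible_FC1_PO :: "target_fun set \<Rightarrow> bool" where
  "compatible_FC1_PO \<Phi> \<longleftrightarrow>
     (\<forall>n\<ge>2. \<forall>\<phi> u act crash x.
        (\<forall>i<n. \<phi> i \<in> \<Phi>) \<and> (\<forall>i<n. u i \<noteq> 0) \<and> fair n act \<and> card (faulty n crash) \<le> 1 \<and>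
        execution n \<phi> u act crash x
        \<longrightarrow> (\<exists>p. \<forall>i<n. (\<lambda>t. x t i) \<longlonglongrightarrow> p))"

definition equilateral_triangle :: "real \<Rightarrow> complex set \<Rightarrow> bool" where
  "equilateral_triangle l T \<longleftrightarrow> l > 0 \<and>
     (\<exists>a b c. T = {a, b, c} \<and> dist a b = l \<and> dist b c = l \<and> dist c a = l)"

definition square :: "real \<Rightarrow> complex set \<Rightarrow> bool" where
  "square l S \<longleftrightarrow> l > 0 \<and>
     (\<exists>a b c d. S = {a, b, c, d} \<and>
        dist a b = l \<and> dist b c = l \<and> dist c d = l \<and> dist d a = l \<and>
        orthogonal (d - a) (b - a) \<and> orthogonal (a - b) (c - b) \<and>
        orthogonal (b - c) (d - c) \<and> orthogonal (c - d) (a - d))"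

definition Psi :: "complex multiset \<Rightarrow> complex set \<Rightarrow> complex set \<Rightarrow> bool" where
  "Psi P T S \<longleftrightarrow> size P = 7 \<and> 0 \<in># P \<and> P = mset_set T + mset_set S \<and>
     (\<exists>l. equilateral_triangle l T \<and> square l S) \<and>
     convex hull T \<inter> convex hull S = {}"

(* T and S are determined by P (another choice would have to exchange two vertices of the
   triangle with two of the square, which the distances rule out), so SOME involves no
   arbitrary choice. *)
definition phi_T :: target_fun where
  "phi_T P =
     (if 0 \<notin># P then None
      else if \<exists>T S. Psi P T S \<and> 0 \<in> T
           then Some (gravity_center (mset_set (SOME T. \<exists>S. Psi P T S \<and> 0 \<in> T)) / 2)
      else Some (gravity_center P))"

definition phi_S :: target_fun where
  "phi_S P =
     (if 0 \<notin># P then None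
      else if \<exists>T S. Psi P T S \<and> 0 \<in> S
           then Some (gravity_center (mset_set (SOME S. \<exists>T. Psi P T S \<and> 0 \<in> S)) / 2)
      else Some (gravity_center P))"

lemma target_function_phi: "target_function phi_T" "target_function phi_S"
  by (auto simp: target_function_def phi_T_def phi_S_def simp del: not_None_eq split: if_splits)

end

theory Submission imports Defs begin

text \<open>
  Compatibility. Project all positions on a direction \<open>w\<close> and let \<open>a\<close> and \<open>b\<close> be the limits of the
  smallest and the largest projection. Suppose \<open>a < b\<close>. Late in the execution, a robot that moves to
  the center of gravity lands deep inside, far from both ends. If a robot that moves halfway to the
  center of its own figure \<open>X\<close> lands near an end, then all of \<open>X\<close> is near that end, so \<open>X\<close> is narrow in
  direction \<open>w\<close>, hence the common side length is small, and the other figure \<open>Y\<close>, which must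
  contain a robot at the opposite end, lies near that end altogether. So a landing near an end is
  impossible if the preceding move put some robot deep inside. Otherwise the preceding move
  contracted a part of a figure \<open>X\<close> at one end and left \<open>Y\<close> at the other end unchanged. Then \<open>Y\<close>
  and its side length persist, whereas a moved point of \<open>X\<close> is closer than the diameter of that
  figure to all its other points, so the configuration does not decompose again.
  Hence all robots that do not crash are eventually deep inside, and a single crashed robot cannot
  be at both ends.

  Incompatibility. If all robots are activated at all times, both figures shrink by one half
  towards their own centers in every step, and their similarity type is preserved. The figures are
  placed so far apart that the decomposition is unique.

  Scale. Moving the figures apart, the target point approaches the boundary of the hull
  relatively to the distance of the center of gravity.
\<close>

section \<open>Triangles and squares\<close>

text \<open>The properties of triangle and square on which convergence rests, so that one argument
  serves both choices of the halved figure. \<open>\<kappa> * l\<close> is the diameter, reached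
  from every vertex; the last clause bounds the width in every direction below by
  \<open>l / 3\<close>.\<close>

definition uniform_shape :: "real \<Rightarrow> nat \<Rightarrow> (real \<Rightarrow> complex set \<Rightarrow> bool) \<Rightarrow> bool" where
  "uniform_shape \<kappa> k sh \<longleftrightarrow> (\<forall>l X. sh l X \<longrightarrow> card X = k \<and> 0 < l
     \<and> (\<forall>p\<in>X. \<forall>q\<in>X. dist p q \<le> \<kappa> * l) \<and> (\<forall>p\<in>X. \<exists>q\<in>X. dist p q = \<kappa> * l)
     \<and> (\<forall>w. norm w = 1 \<longrightarrow> (\<exists>p\<in>X. \<exists>q\<in>X. l \<le> 3 * (w \<bullet> p - w \<bullet> q))))"

text \<open>\<open>D\<close> is the determinant of \<open>u\<close> and \<open>v\<close>; Lagrange's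
  identity and the bound on \<open>u \<bullet> v\<close> make it large. \<open>z\<close> is
  \<open>w\<close> turned by a right angle and multiplied by \<open>D\<close>, so the triangle
  inequality for \<open>z\<close> bounds the sum of the two projections from below.\<close>

lemma width_of_frame:
  fixes u v w :: complex
  assumes w: "norm w = 1" and u: "norm u = l" and v: "norm v = l" and l: "0 < l"
    and uv: "\<bar>u \<bullet> v\<bar> \<le> l\<^sup>2 / 2"
  shows "l / 3 \<le> \<bar>w \<bullet> u\<bar> \<or> l / 3 \<le> \<bar>w \<bullet> v\<bar>"
proof -
  define D where "D = Re u * Im v - Im u * Re v"
  have u2: "(Re u)\<^sup>2 + (Im u)\<^sup>2 = l\<^sup>2" and v2: "(Re v)\<^sup>2 + (Im v)\<^sup>2 = l\<^sup>2"
    and w2: "(Re w)\<^sup>2 + (Im w)\<^sup>2 = 1"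
    using u v w cmod_power2[of u] cmod_power2[of v] cmod_power2[of w] by simp_all
  have "D\<^sup>2 + (u \<bullet> v)\<^sup>2 = ((Re u)\<^sup>2 + (Im u)\<^sup>2) * ((Re v)\<^sup>2 + (Im v)\<^sup>2)"
    by (simp add: D_def inner_complex_def algebra_simps power2_eq_square)
  then have D2: "D\<^sup>2 + (u \<bullet> v)\<^sup>2 = l\<^sup>2 * l\<^sup>2"
    by (simp add: u2 v2)
  have "(u \<bullet> v)\<^sup>2 \<le> (l\<^sup>2 / 2)\<^sup>2"
    using power_mono[OF uv, of 2] by simp
  then have "D\<^sup>2 \<ge> 3 / 4 * (l\<^sup>2 * l\<^sup>2)"
    using D2 by (simp add: power2_eq_square)
  \<comment> \<open>\<open>2 / 3\<close> is a rational number below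
    \<open>sqrt 3 / 2\<close>.\<close>
  moreover have "(2 / 3 * l\<^sup>2)\<^sup>2 \<le> 3 / 4 * (l\<^sup>2 * l\<^sup>2)"
    using l by (simp add: power2_eq_square)
  ultimately have "(2 / 3 * l\<^sup>2)\<^sup>2 \<le> D\<^sup>2"
    by linarith
  then have D: "2 / 3 * l\<^sup>2 \<le> \<bar>D\<bar>"
    by (metis abs_le_square_iff abs_ge_self order_trans)
  define z where "z = (w \<bullet> u) *\<^sub>R v - (w \<bullet> v) *\<^sub>R u"
  have "(norm z)\<^sup>2 = D\<^sup>2 * ((Re w)\<^sup>2 + (Im w)\<^sup>2)"
    unfolding cmod_power2 by (simp add: z_def D_def inner_complex_def algebra_simps power2_eq_square)
  then have "(norm z)\<^sup>2 = \<bar>D\<bar>\<^sup>2"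
    by (simp add: w2)
  then have "norm z = \<bar>D\<bar>"
    by (rule power2_eq_imp_eq) simp_all
  moreover have "norm z \<le> \<bar>w \<bullet> u\<bar> * l + \<bar>w \<bullet> v\<bar> * l"
    unfolding z_def by (rule order_trans[OF norm_triangle_ineq4]) (simp add: u v)
  ultimately have "2 / 3 * l * l \<le> (\<bar>w \<bullet> u\<bar> + \<bar>w \<bullet> v\<bar>) * l"
    using D by (simp add: algebra_simps power2_eq_square)
  then have "2 / 3 * l \<le> \<bar>w \<bullet> u\<bar> + \<bar>w \<bullet> v\<bar>"
    by (rule mult_right_le_imp_le[OF _ l])
  then show ?thesis by linarith
qed

lemma width_of_angle:
  fixes a b c w :: complex
  assumes "norm w = 1" "dist a b = l" "dist a c = l" "0 < l" "\<bar>(b - a) \<bullet> (c - a)\<bar> \<le> l\<^sup>2 / 2"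
  shows "\<exists>p\<in>{a, b, c}. \<exists>q\<in>{a, b, c}. l \<le> 3 * (w \<bullet> p - w \<bullet> q)"
proof -
  have "l / 3 \<le> \<bar>w \<bullet> (b - a)\<bar> \<or> l / 3 \<le> \<bar>w \<bullet> (c - a)\<bar>"
    using assms by (intro width_of_frame) (auto simp: dist_norm norm_minus_commute)
  then show ?thesis
    by (auto simp: inner_diff_right abs_if split: if_splits)
qed

lemma equilateral_triangle_uniform: "uniform_shape 1 3 equilateral_triangle"
  unfolding uniform_shape_def
proof (intro allI impI)
  fix l X assume "equilateral_triangle l X"
  then obtain a b c where l: "0 < l" and X: "X = {a, b, c}"
    and d: "dist a b = l" "dist b c = l" "dist c a = l"
    by (auto simp: equilateral_triangle_def)
  have d': "dist b a = l" "dist c b = l" "dist a c = l"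
    using d by (simp_all add: dist_commute)
  have "a \<noteq> b" "b \<noteq> c" "c \<noteq> a" using l d by fastforce+
  then have "card X = 3" by (simp add: X)
  moreover have "\<forall>p\<in>X. \<forall>q\<in>X. dist p q \<le> 1 * l" "\<forall>p\<in>X. \<exists>q\<in>X. dist p q = 1 * l"
    using l by (simp_all add: X d d')
  moreover have "\<exists>p\<in>X. \<exists>q\<in>X. l \<le> 3 * (w \<bullet> p - w \<bullet> q)" if "norm w = 1" for w
  proof -
    \<comment> \<open>Law of cosines: the angle of 60 degrees gives exactly the extreme inner
      product that \<open>width_of_angle\<close> admits.\<close>
    have "(norm (b - c))\<^sup>2 = (norm (b - a))\<^sup>2 - 2 * ((b - a) \<bullet> (c - a)) + (norm (c - a))\<^sup>2"
      unfolding power2_norm_eq_inner by (simp add: algebra_simps inner_commute)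
    then have "(b - a) \<bullet> (c - a) = l\<^sup>2 / 2"
      by (simp add: d d' flip: dist_norm)
    then have "\<bar>(b - a) \<bullet> (c - a)\<bar> = l\<^sup>2 / 2"
      by (metis abs_of_nonneg zero_le_power2 divide_nonneg_pos zero_less_numeral)
    then show ?thesis
      unfolding X using that d d' l by (intro width_of_angle) simp_all
  qed
  ultimately show "card X = 3 \<and> 0 < l \<and> (\<forall>p\<in>X. \<forall>q\<in>X. dist p q \<le> 1 * l)
    \<and> (\<forall>p\<in>X. \<exists>q\<in>X. dist p q = 1 * l)
    \<and> (\<forall>w. norm w = 1 \<longrightarrow> (\<exists>p\<in>X. \<exists>q\<in>X. l \<le> 3 * (w \<bullet> p - w \<bullet> q)))"
    using l by blast
qed

lemma dist_right_angle:
  fixes a b c :: complex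
  assumes "dist a b = l" "dist b c = l" "0 < l" "orthogonal (a - b) (c - b)"
  shows "dist a c = sqrt 2 * l"
proof -
  have "(norm (a - c))\<^sup>2 = (norm (a - b))\<^sup>2 - 2 * ((a - b) \<bullet> (c - b)) + (norm (c - b))\<^sup>2"
    unfolding power2_norm_eq_inner by (simp add: algebra_simps inner_commute)
  then have "(dist a c)\<^sup>2 = (sqrt 2 * l)\<^sup>2"
    using assms by (simp add: orthogonal_def dist_norm norm_minus_commute power_mult_distrib)
  then show ?thesis
    by (rule power2_eq_imp_eq) (use assms in auto)
qed

lemma square_uniform: "uniform_shape (sqrt 2) 4 square"
  unfolding uniform_shape_def
proof (intro allI impI)
  fix l X assume "square l X"
  then obtain a b c d where l: "0 < l" and X: "X = {a, b, c, d}"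
    and d: "dist a b = l" "dist b c = l" "dist c d = l" "dist d a = l"
    and o: "orthogonal (d - a) (b - a)" "orthogonal (a - b) (c - b)" "orthogonal (b - c) (d - c)"
    unfolding square_def by blast
  have diag: "dist a c = sqrt 2 * l" "dist b d = sqrt 2 * l"
    by (rule dist_right_angle[OF d(1,2) l o(2)], rule dist_right_angle[OF d(2,3) l o(3)])
  then have diag': "dist c a = sqrt 2 * l" "dist d b = sqrt 2 * l"
    by (simp_all add: dist_commute)
  have d': "dist b a = l" "dist c b = l" "dist d c = l" "dist a d = l"
    using d by (simp_all add: dist_commute)
  have less: "l < sqrt 2 * l" using l by simp
  have ne: "p \<noteq> q" if "dist p q = l \<or> dist p q = sqrt 2 * l" for p q :: complex
    using that l by auto
  have "a \<noteq> b" "a \<noteq> c" "a \<noteq> d" "b \<noteq> c" "b \<noteq> d" "c \<noteq> d"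
    by (intro ne; simp only: d d' diag simp_thms)+
  then have "card X = 4" by (simp add: X)
  moreover have "\<forall>p\<in>X. \<forall>q\<in>X. dist p q \<le> sqrt 2 * l" "\<forall>p\<in>X. \<exists>q\<in>X. dist p q = sqrt 2 * l"
    using l d d' diag diag' less by (simp_all add: X)
  moreover have "\<exists>p\<in>X. \<exists>q\<in>X. l \<le> 3 * (w \<bullet> p - w \<bullet> q)" if "norm w = 1" for w
  proof -
    have "\<exists>p\<in>{a, b, d}. \<exists>q\<in>{a, b, d}. l \<le> 3 * (w \<bullet> p - w \<bullet> q)"
      using that d d' o l by (intro width_of_angle) (simp_all add: orthogonal_def inner_commute)
    then show ?thesis unfolding X by blast
  qed
  ultimately show "card X = 4 \<and> 0 < l \<and> (\<forall>p\<in>X. \<forall>q\<in>X. dist p q \<le> sqrt 2 * l)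
    \<and> (\<forall>p\<in>X. \<exists>q\<in>X. dist p q = sqrt 2 * l)
    \<and> (\<forall>w. norm w = 1 \<longrightarrow> (\<exists>p\<in>X. \<exists>q\<in>X. l \<le> 3 * (w \<bullet> p - w \<bullet> q)))"
    using l by blast
qed

section \<open>Centers of gravity and projections\<close>

text \<open>Quantifies how a single low entry pulls an average away from an upper bound. It is
  applied to projections and, in \<open>dist_gravity_center_less\<close>, to distances.\<close>

lemma average_le:
  fixes h :: "'a \<Rightarrow> real"
  assumes "finite I" "j \<in> I" "\<And>i. i \<in> I \<Longrightarrow> h i \<le> B"
  shows "sum h I / card I \<le> B - (B - h j) / card I"
proof -
  have "B - h j \<le> (\<Sum>i\<in>I. B - h i)"
    using assms by (intro member_le_sum) auto
  also have "\<dots> = card I * B - sum h I"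
    by (simp add: sum_subtractf)
  finally have "sum h I \<le> card I * B - (B - h j)" by simp
  moreover have "0 < card I" using assms by (auto simp: card_gt_0_iff)
  ultimately show ?thesis by (simp add: field_simps)
qed

lemma divide_of_nat_complex: "z / of_nat k = (1 / real k) *\<^sub>R (z::complex)"
  by (simp add: scaleR_conv_of_real)

lemma gravity_center_mset_set:
  "gravity_center (mset_set X) = (1 / real (card X)) *\<^sub>R \<Sum>X"
  by (simp add: gravity_center_def sum_unfold_sum_mset divide_of_nat_complex)

lemma gravity_center_configuration:
  "gravity_center (configuration n x) = (1 / real n) *\<^sub>R (\<Sum>i<n. x i)"
  by (simp add: gravity_center_def configuration_def sum_unfold_sum_mset divide_of_nat_complex)

lemma gravity_center_in_convex_hull:
  assumes "P \<noteq> {#}"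
  shows "gravity_center P \<in> convex hull set_mset P"
proof -
  obtain xs where P: "P = mset xs" by (metis ex_mset)
  let ?n = "length xs"
  have "(\<Sum>i<?n. (1 / real ?n) *\<^sub>R xs ! i) \<in> convex hull set xs"
    using assms by (intro convex_sum) (auto simp: P hull_inc)
  moreover have "gravity_center P = (1 / real ?n) *\<^sub>R (\<Sum>i<?n. xs ! i)"
    by (simp add: P gravity_center_def divide_of_nat_complex sum_mset_sum_list sum_list_sum_nth
        atLeast0LessThan)
  ultimately show ?thesis
    by (simp add: P scaleR_right.sum)
qed

lemma gravity_center_in_hull:
  assumes "finite X" "X \<noteq> {}"
  shows "gravity_center (mset_set X) \<in> convex hull X"
  using gravity_center_in_convex_hull[of "mset_set X"] assms by (simp add: mset_set_empty_iff)

text \<open>\<open>(p + g) / 2\<close> is the global form of the target \<open>g / 2\<close>, which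
  is given in coordinates with origin \<open>p\<close>.\<close>

lemma halfway_in_hull:
  assumes "finite X" "p \<in> X"
  shows "(p + gravity_center (mset_set X)) / 2 \<in> convex hull X"
proof -
  have "(1/2) *\<^sub>R p + (1/2) *\<^sub>R gravity_center (mset_set X) \<in> convex hull X"
    using assms by (intro convexD gravity_center_in_hull) (auto simp: hull_inc)
  then show ?thesis
    by (simp add: scaleR_conv_of_real add_divide_distrib)
qed


lemma inner_half: "w \<bullet> (z / 2) = (w \<bullet> z) / 2" for w z :: complex
  by (metis divide_of_nat_complex inner_scaleR_right mult_1 of_nat_numeral times_divide_eq_left)

lemma inner_gravity_center_mset_set:
  "w \<bullet> gravity_center (mset_set X) = (\<Sum>q\<in>X. w \<bullet> q) / card X"
  by (simp add: gravity_center_mset_set inner_sum_right)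

text \<open>With at most four vertices, each vertex \<open>q\<close> has weight at least
  \<open>1 / 4\<close> in the center and hence at least \<open>1 / 8\<close> in the midpoint. So a
  midpoint close to the bound \<open>B\<close> forces every vertex close to
  \<open>B\<close>.\<close>

lemma inner_halfway_le:
  assumes "finite X" "p \<in> X" "q \<in> X" "card X \<le> 4" "\<And>r. r \<in> X \<Longrightarrow> w \<bullet> r \<le> B"
  shows "w \<bullet> ((p + gravity_center (mset_set X)) / 2) \<le> (w \<bullet> q) / 8 + 7 / 8 * B"
proof -
  have "0 < card X" using assms by (auto simp: card_gt_0_iff)
  have "w \<bullet> gravity_center (mset_set X) \<le> B - (B - w \<bullet> q) / card X"
    unfolding inner_gravity_center_mset_set using assms by (intro average_le) auto
  also have "(B - w \<bullet> q) / 4 \<le> (B - w \<bullet> q) / card X"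
    using assms \<open>0 < card X\<close> by (intro divide_left_mono) auto
  then have "B - (B - w \<bullet> q) / card X \<le> B - (B - w \<bullet> q) / 4"
    by simp
  finally show ?thesis
    using assms(5)[OF assms(2)] by (simp add: inner_half inner_add_right field_simps)
qed

lemma uniform_shapeD:
  assumes "uniform_shape \<kappa> k sh" "sh l X"
  shows "card X = k" "0 < l" "\<And>p q. p \<in> X \<Longrightarrow> q \<in> X \<Longrightarrow> dist p q \<le> \<kappa> * l"
    and "\<And>p. p \<in> X \<Longrightarrow> \<exists>q\<in>X. dist p q = \<kappa> * l"
    and "\<And>w. norm w = 1 \<Longrightarrow> \<exists>p\<in>X. \<exists>q\<in>X. l \<le> 3 * (w \<bullet> p - w \<bullet> q)"
  using assms unfolding uniform_shape_def by blast+

lemma uniform_shape_nonempty: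
  assumes "uniform_shape \<kappa> k sh" "sh l X"
  shows "X \<noteq> {}"
  using uniform_shapeD(5)[OF assms, of 1] by auto

text \<open>Both lengths are the diameter of \<open>X\<close> divided by
  \<open>\<kappa>\<close>.\<close>

lemma uniform_shape_side_unique:
  assumes u: "uniform_shape \<kappa> k sh" and "0 < \<kappa>" and X: "sh l X" "sh l' X"
  shows "l = l'"
proof -
  obtain p where "p \<in> X" using uniform_shape_nonempty[OF u X(1)] by blast
  then obtain q q' where "q \<in> X" "dist p q = \<kappa> * l" "q' \<in> X" "dist p q' = \<kappa> * l'"
    using uniform_shapeD(4)[OF u] X by metis
  then have "\<kappa> * l \<le> \<kappa> * l'" "\<kappa> * l' \<le> \<kappa> * l"
    using uniform_shapeD(3)[OF u X(1) \<open>p \<in> X\<close>] uniform_shapeD(3)[OF u X(2) \<open>p \<in> X\<close>] by metis+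
  then show ?thesis using \<open>0 < \<kappa>\<close> by simp
qed

text \<open>The inequality is strict because \<open>q\<close> itself takes part in the average, at
  distance 0 from \<open>q\<close>.\<close>

lemma dist_gravity_center_less:
  assumes "finite X" "q \<in> X" "0 < D" and D: "\<And>r. r \<in> X \<Longrightarrow> dist r q \<le> D"
  shows "dist (gravity_center (mset_set X)) q < D"
proof -
  have k: "0 < card X" using assms by (auto simp: card_gt_0_iff)
  have "gravity_center (mset_set X) - q = (1 / card X) *\<^sub>R (\<Sum>r\<in>X. r - q)"
    using k by (simp add: gravity_center_mset_set sum_subtractf scaleR_conv_of_real
        right_diff_distrib)
  then have "dist (gravity_center (mset_set X)) q \<le> (\<Sum>r\<in>X. dist r q) / card X"
    using k norm_sum[of "\<lambda>r. r - q" X] by (simp add: dist_norm divide_right_mono)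
  also have "\<dots> \<le> D - (D - dist q q) / card X"
    using assms by (intro average_le) auto
  also have "\<dots> < D" using k \<open>0 < D\<close> by simp
  finally show ?thesis .
qed

text \<open>The midpoint averages \<open>p\<close>, within the diameter of each vertex, and the
  center, strictly within it. The bound passes from the vertices to the hull since open balls are
  convex. It shows that a moved vertex has lost its partner at distance
  \<open>\<kappa> * l\<close>.\<close>

lemma dist_halfway_less:
  assumes u: "uniform_shape \<kappa> k sh" and "0 < \<kappa>" "0 < k" and X: "sh l X"
    and p: "p \<in> X" and z: "z \<in> convex hull X"
  shows "dist ((p + gravity_center (mset_set X)) / 2) z < \<kappa> * l"
proof -
  let ?g = "gravity_center (mset_set X)"
  have fin: "finite X" using uniform_shapeD(1)[OF u X] \<open>0 < k\<close> by (simp add: card_ge_0_finite)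
  have pos: "0 < \<kappa> * l" using uniform_shapeD(2)[OF u X] \<open>0 < \<kappa>\<close> by simp
  have "dist ((p + ?g) / 2) q < \<kappa> * l" if q: "q \<in> X" for q
  proof -
    have "(p + ?g) / 2 - q = (1/2) *\<^sub>R (p - q) + (1/2) *\<^sub>R (?g - q)"
      by (simp add: scaleR_conv_of_real field_simps)
    then have "dist ((p + ?g) / 2) q \<le> dist p q / 2 + dist ?g q / 2"
      unfolding dist_norm by (metis norm_triangle_ineq norm_scaleR abs_of_nonneg zero_le_divide_1_iff
          zero_le_numeral mult.commute mult_1_right times_divide_eq_right)
    moreover have "dist ?g q < \<kappa> * l"
      using uniform_shapeD(3)[OF u X _ q] fin q pos by (intro dist_gravity_center_less)
    ultimately show ?thesis using uniform_shapeD(3)[OF u X p q] by linarith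
  qed
  then have "X \<subseteq> ball ((p + ?g) / 2) (\<kappa> * l)" by auto
  then have "convex hull X \<subseteq> ball ((p + ?g) / 2) (\<kappa> * l)"
    by (intro hull_minimal convex_ball)
  then show ?thesis using z by auto
qed

section \<open>Configurations split by a line, and their extent in a direction\<close>

lemma set_mset_configuration [simp]: "set_mset (configuration n x) = x ` {..<n}"
  by (simp add: configuration_def)

text \<open>A separating line turns the two figures into two sets of robots. The robots on each side
  are at least as many as the points of the figure there, and both pairs of numbers add up to
  \<open>n\<close>, so they agree.\<close>

lemma separated_configuration:
  assumes conf: "configuration n x = mset_set X + mset_set Y" and fin: "finite X" "finite Y"
    and X: "\<forall>q\<in>X. c < w \<bullet> q" and Y: "\<forall>q\<in>Y. w \<bullet> q < c"
  shows "X = x ` {i. i < n \<and> c < w \<bullet> x i}" "Y = x ` {i. i < n \<and> \<not> c < w \<bullet> x i}"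
    "card {i. i < n \<and> c < w \<bullet> x i} = card X" "card {i. i < n \<and> \<not> c < w \<bullet> x i} = card Y"
proof -
  let ?U = "{i. i < n \<and> c < w \<bullet> x i}" and ?V = "{i. i < n \<and> \<not> c < w \<bullet> x i}"
  have "x ` {..<n} = X \<union> Y"
    using arg_cong[OF conf, of set_mset] fin by simp
  moreover have "X = {q \<in> X \<union> Y. c < w \<bullet> q}" "Y = {q \<in> X \<union> Y. \<not> c < w \<bullet> q}"
    using X Y by (auto dest: order.asym)
  ultimately have "X = {q \<in> x ` {..<n}. c < w \<bullet> q}" "Y = {q \<in> x ` {..<n}. \<not> c < w \<bullet> q}"
    by simp_all
  then show XU: "X = x ` ?U" and YV: "Y = x ` ?V"
    by auto
  have "n = card X + card Y"
    using arg_cong[OF conf, of size] by (simp add: configuration_def)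
  moreover have "card ?U + card ?V = n"
  proof -
    have "card (?U \<union> ?V) = card ?U + card ?V" by (rule card_Un_disjoint) auto
    moreover have "?U \<union> ?V = {..<n}" by auto
    ultimately show ?thesis by simp
  qed
  moreover have "card X \<le> card ?U" "card Y \<le> card ?V"
    using card_image_le[of ?U x] card_image_le[of ?V x] by (simp_all flip: XU YV)
  ultimately show "card ?U = card X" "card ?V = card Y" by linarith+
qed

definition split_by :: "complex \<Rightarrow> real \<Rightarrow> complex set \<Rightarrow> complex set \<Rightarrow> bool" where
  "split_by w c X Y \<longleftrightarrow> (\<forall>q\<in>X. c < w \<bullet> q) \<and> (\<forall>q\<in>Y. w \<bullet> q < c)
     \<or> (\<forall>q\<in>X. w \<bullet> q < c) \<and> (\<forall>q\<in>Y. c < w \<bullet> q)"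

lemma split_byI:
  assumes "(\<forall>q\<in>X. b < w \<bullet> q) \<and> (\<forall>q\<in>Y. w \<bullet> q < a) \<or> (\<forall>q\<in>X. w \<bullet> q < a) \<and> (\<forall>q\<in>Y. b < w \<bullet> q)"
    and "a \<le> c" "c \<le> b"
  shows "split_by w c X Y"
  using assms unfolding split_by_def by (meson less_le_trans le_less_trans)

lemma split_by_uminus: "split_by (- w) (- c) X Y \<longleftrightarrow> split_by w c X Y"
  by (auto simp: split_by_def)

text \<open>Describes late times at which the smallest projection, increasing to \<open>a\<close>,
  and the largest, decreasing to \<open>b\<close>, have come within \<open>e\<close> of their
  limits.\<close>

definition spread :: "nat \<Rightarrow> complex \<Rightarrow> real \<Rightarrow> real \<Rightarrow> real \<Rightarrow> (nat \<Rightarrow> complex) \<Rightarrow> bool" where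
  "spread n w a b e y \<longleftrightarrow> (\<forall>i<n. a - e \<le> w \<bullet> y i \<and> w \<bullet> y i \<le> b + e)
     \<and> (\<exists>i<n. w \<bullet> y i \<le> a) \<and> (\<exists>i<n. b \<le> w \<bullet> y i)"

lemma spread_uminus: "spread n w a b e y \<Longrightarrow> spread n (- w) (- b) (- a) e y"
  unfolding spread_def by (auto simp: algebra_simps)

text \<open>The robot at or below \<open>a\<close> pulls the average down by its share; the
  overshoot beyond \<open>b\<close> costs at most \<open>e\<close>.\<close>

lemma gravity_center_upper:
  assumes "spread n w a b e y"
  shows "w \<bullet> gravity_center (configuration n y) \<le> b - ((b - a) / n - e)"
proof -
  obtain j where j: "j < n" "w \<bullet> y j \<le> a" using assms by (auto simp: spread_def)
  then have e: "(b + e - a) / n \<le> (b + e - w \<bullet> y j) / n"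
    by (simp add: divide_right_mono)
  have "w \<bullet> gravity_center (configuration n y) = (\<Sum>i<n. w \<bullet> y i) / card {..<n}"
    by (simp add: gravity_center_configuration inner_sum_right)
  also have "\<dots> \<le> b + e - (b + e - w \<bullet> y j) / card {..<n}"
    using assms j by (intro average_le) (auto simp: spread_def)
  also have "\<dots> \<le> b + e - (b + e - a) / n" using e by simp
  finally have *: "w \<bullet> gravity_center (configuration n y) \<le> b + e - (b + e - a) / n" .
  have "0 \<le> e"
    using assms unfolding spread_def by (metis add_le_cancel_left add.right_neutral order_trans)
  then have "(b - a) / n \<le> (b + e - a) / n" by (simp add: divide_right_mono)
  then show ?thesis using * by linarith
qed

lemma gravity_center_deep:
  assumes "spread n w a b e y"
  shows "a + ((b - a) / n - e) \<le> w \<bullet> gravity_center (configuration n y)"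
    "w \<bullet> gravity_center (configuration n y) \<le> b - ((b - a) / n - e)"
  using gravity_center_upper[OF assms] gravity_center_upper[OF spread_uminus[OF assms]]
  by (simp_all add: algebra_simps)


section \<open>Convergence with at most one crash\<close>

text \<open>
  \<open>X\<close> is the figure whose robots move halfway to its center, \<open>Y\<close> the other one.
\<close>
locale gathering =
  fixes shX shY :: "real \<Rightarrow> complex set \<Rightarrow> bool" and \<kappa>X \<kappa>Y :: real and kX kY :: nat
  assumes shX: "uniform_shape \<kappa>X kX shX" and shY: "uniform_shape \<kappa>Y kY shY"
    and \<kappa>: "0 < \<kappa>X" "0 < \<kappa>Y" "\<kappa>Y \<le> 2"
    and k: "0 < kX" "kX \<le> 4" "0 < kY" "kX \<noteq> kY"
begin

definition decomposes :: "complex multiset \<Rightarrow> complex set \<Rightarrow> complex set \<Rightarrow> real \<Rightarrow> bool" where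
  "decomposes P X Y l \<longleftrightarrow> P = mset_set X + mset_set Y \<and> shX l X \<and> shY l Y"

lemma decomposes_finite:
  assumes "decomposes P X Y l"
  shows "finite X" "finite Y" "card X = kX" "card Y = kY"
  using assms uniform_shapeD(1)[OF shX] uniform_shapeD(1)[OF shY] k
  by (auto simp: decomposes_def intro: card_ge_0_finite)

lemma decomposes_set:
  assumes "decomposes (configuration n y) X Y l"
  shows "y ` {..<n} = X \<union> Y"
  using arg_cong[of "configuration n y" _ set_mset] assms decomposes_finite[OF assms]
  by (metis decomposes_def finite_set_mset_mset_set set_mset_configuration set_mset_union)

text \<open>By \<open>inner_halfway_le\<close> all of \<open>X\<close> lies in a strip of width
  below \<open>16 * s\<close>, so \<open>l < 48 * s\<close>. The robot at or below \<open>a\<close>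
  then belongs to \<open>Y\<close>, whose diameter is at most \<open>2 * l < 96 * s\<close>. The
  value \<open>100 * s\<close> covers both figures.\<close>

lemma halfway_near_top:
  assumes w: "norm w = 1" and sp: "spread n w a b e y"
    and dec: "decomposes (configuration n y) X Y l" and p: "p \<in> X"
    and es: "e \<le> s" "15 * s < b - a"
    and near: "b - s < w \<bullet> ((p + gravity_center (mset_set X)) / 2)"
  shows "(\<forall>q\<in>X. b - 100 * s < w \<bullet> q) \<and> (\<forall>q\<in>Y. w \<bullet> q < a + 100 * s)"
proof -
  have X: "shX l X" and Y: "shY l Y" using dec by (auto simp: decomposes_def)
  note fin = decomposes_finite[OF dec] and set = decomposes_set[OF dec]
  have le: "w \<bullet> q \<le> b + e" if "q \<in> X \<union> Y" for q
    using that sp unfolding set[symmetric] spread_def by auto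
  have low: "b - 15 * s < w \<bullet> q" if q: "q \<in> X" for q
  proof -
    have "w \<bullet> ((p + gravity_center (mset_set X)) / 2) \<le> (w \<bullet> q) / 8 + 7 / 8 * (b + e)"
      using p q fin k le by (intro inner_halfway_le) auto
    then show ?thesis using near es by argo
  qed
  obtain p' q' where "p' \<in> X" "q' \<in> X" "l \<le> 3 * (w \<bullet> p' - w \<bullet> q')"
    using uniform_shapeD(5)[OF shX X w] by blast
  then have l: "l < 48 * s"
    using low[of q'] le[of p'] es by simp
  obtain j where "j < n" "w \<bullet> y j \<le> a" using sp by (auto simp: spread_def)
  \<comment> \<open>All of \<open>X\<close> lies above \<open>b - 15 * s\<close>, which exceeds
    \<open>a\<close>.\<close>
  then have "y j \<in> Y" using set low[of "y j"] es by fastforce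
  have "w \<bullet> q < a + 100 * s" if q: "q \<in> Y" for q
  proof -
    have "w \<bullet> q - w \<bullet> y j \<le> dist q (y j)"
      using Cauchy_Schwarz_ineq2[of w "q - y j"] w by (simp add: inner_diff_right dist_norm)
    also have "\<dots> \<le> \<kappa>Y * l" using uniform_shapeD(3)[OF shY Y q \<open>y j \<in> Y\<close>] .
    also have "\<dots> \<le> 2 * l" using \<kappa> uniform_shapeD(2)[OF shY Y] by simp
    finally show ?thesis
      using l \<open>w \<bullet> y j \<le> a\<close> uniform_shapeD(2)[OF shY Y] by simp
  qed
  moreover have "0 < s" using l uniform_shapeD(2)[OF shY Y] by simp
  ultimately show ?thesis using low by fastforce
qed

lemma halfway_near_end:
  assumes w: "norm w = 1" and sp: "spread n w a b e y"
    and dec: "decomposes (configuration n y) X Y l" and p: "p \<in> X"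
    and es: "e \<le> s" "15 * s < b - a"
    and near: "\<not> (a + s \<le> w \<bullet> ((p + gravity_center (mset_set X)) / 2)
      \<and> w \<bullet> ((p + gravity_center (mset_set X)) / 2) \<le> b - s)"
  shows "(\<forall>q\<in>X. b - 100 * s < w \<bullet> q) \<and> (\<forall>q\<in>Y. w \<bullet> q < a + 100 * s)
    \<or> (\<forall>q\<in>X. w \<bullet> q < a + 100 * s) \<and> (\<forall>q\<in>Y. b - 100 * s < w \<bullet> q)"
proof (cases "b - s < w \<bullet> ((p + gravity_center (mset_set X)) / 2)")
  case True
  then show ?thesis using halfway_near_top[OF w sp dec p es] by blast
next
  case False
  \<comment> \<open>Replacing \<open>w\<close> by \<open>- w\<close> exchanges the two ends.\<close>
  then have "(\<forall>q\<in>X. - a - 100 * s < - w \<bullet> q) \<and> (\<forall>q\<in>Y. - w \<bullet> q < - b + 100 * s)"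
    using w near es by (intro halfway_near_top[OF _ spread_uminus[OF sp] dec p es(1)]) auto
  then show ?thesis by (force simp: algebra_simps)
qed

text \<open>No robot changes sides: movers belong to \<open>X0\<close> and stay in its hull, and the
  robots of \<open>Y0\<close> rest. A second split therefore has the same \<open>Y\<close> and the
  same side length. But the moved \<open>i0\<close> would need a partner at distance
  \<open>\<kappa>X * l0\<close> inside the hull of \<open>X0\<close>, where all points are
  closer.\<close>

lemma no_second_split_top:
  assumes stay: "\<And>i. i < n \<Longrightarrow> i \<notin> E \<Longrightarrow> y' i = y i"
    and move: "\<And>i. i < n \<Longrightarrow> i \<in> E \<Longrightarrow> \<exists>X Y l. decomposes (configuration n y) X Y l \<and> y i \<in> X
       \<and> y' i = (y i + gravity_center (mset_set X)) / 2 \<and> split_by w c X Y"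
    and i0: "i0 < n" "i0 \<in> E"
    and dec0: "decomposes (configuration n y) X0 Y0 l0"
    and top: "\<forall>q\<in>X0. c < w \<bullet> q" "\<forall>q\<in>Y0. w \<bullet> q < c"
    and dec1: "decomposes (configuration n y') X1 Y1 l1" and split: "split_by w c X1 Y1"
  shows False
proof -
  let ?U = "{i. i < n \<and> c < w \<bullet> y i}" and ?V = "{i. i < n \<and> \<not> c < w \<bullet> y i}"
  note fin0 = decomposes_finite[OF dec0]
  have c0: "configuration n y = mset_set X0 + mset_set Y0" and X0: "shX l0 X0" and Y0: "shY l0 Y0"
    using dec0 by (auto simp: decomposes_def)
  note sep0 = separated_configuration[OF c0 fin0(1,2) top]
  \<comment> \<open>Different movers may a priori refer to different decompositions; the line forces
    all of them to use \<open>X0\<close>.\<close>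
  have moved: "y i \<in> X0 \<and> y' i = (y i + gravity_center (mset_set X0)) / 2" if i: "i < n" "i \<in> E" for i
  proof -
    obtain X Y l where dec: "decomposes (configuration n y) X Y l" and yi: "y i \<in> X"
      "y' i = (y i + gravity_center (mset_set X)) / 2" and sp: "split_by w c X Y"
      using move[OF i] by blast
    note fin = decomposes_finite[OF dec]
    have cf: "configuration n y = mset_set X + mset_set Y"
      using dec by (simp add: decomposes_def)
    \<comment> \<open>With the figures exchanged, the upper side would hold \<open>kY\<close> robots
      instead of \<open>kX\<close>.\<close>
    have "\<not> ((\<forall>q\<in>X. w \<bullet> q < c) \<and> (\<forall>q\<in>Y. c < w \<bullet> q))"
      using separated_configuration(3)[of n y Y X c w] cf fin fin0 sep0(3) k by auto
    then have "X = y ` ?U"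
      using sp unfolding split_by_def by (intro separated_configuration(1)[OF cf fin(1,2)]) blast+
    then show ?thesis using yi sep0(1) by simp
  qed
  have hull: "convex hull X0 \<subseteq> {z. c < w \<bullet> z}"
    using top(1) by (intro hull_minimal) (auto intro: convex_halfspace_gt)
  have U: "y' i \<in> convex hull X0" if i: "i \<in> ?U" for i
  proof (cases "i \<in> E")
    case True
    then show ?thesis using moved[of i] i halfway_in_hull[OF fin0(1), of "y i"] by (simp only: mem_Collect_eq)
  next
    case False
    then show ?thesis using stay[of i] i sep0(1) hull_inc[of "y i" X0] by auto
  qed
  have V: "y' i = y i" if i: "i \<in> ?V" for i
  proof (cases "i \<in> E")
    case True
    then show ?thesis using moved[of i] i top(1) by auto
  qed (use stay i in auto)
  have "c < w \<bullet> y' i \<longleftrightarrow> c < w \<bullet> y i" if "i < n" for i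
  proof (cases "c < w \<bullet> y i")
    case True
    then have "y' i \<in> {z. c < w \<bullet> z}" using U[of i] hull that by blast
    then show ?thesis using True by simp
  qed (use V[of i] that in simp)
  then have U': "{i. i < n \<and> c < w \<bullet> y' i} = ?U"
    by blast
  then have V': "{i. i < n \<and> \<not> c < w \<bullet> y' i} = ?V"
    by blast
  note fin1 = decomposes_finite[OF dec1]
  have c1: "configuration n y' = mset_set X1 + mset_set Y1" and X1: "shX l1 X1" and Y1: "shY l1 Y1"
    using dec1 by (auto simp: decomposes_def)
  \<comment> \<open>The upper side still holds the same \<open>kX\<close> robots, so counting again
    excludes the exchanged position.\<close>
  have "\<not> ((\<forall>q\<in>X1. w \<bullet> q < c) \<and> (\<forall>q\<in>Y1. c < w \<bullet> q))"
    using separated_configuration(3)[of n y' Y1 X1 c w] c1 fin1 fin0 sep0(3) k by (auto simp: U')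
  then have top1: "\<forall>q\<in>X1. c < w \<bullet> q" "\<forall>q\<in>Y1. w \<bullet> q < c"
    using split by (auto simp: split_by_def)
  have X1': "X1 = y' ` ?U" and "Y1 = y' ` ?V"
    using separated_configuration(1,2)[OF c1 fin1(1,2) top1] unfolding U' V' by blast+
  then have "Y1 = Y0" using V sep0(2) by simp
  then have l: "l1 = l0"
    using uniform_shape_side_unique[OF shY \<kappa>(2)] Y0 Y1 by blast
  have "i0 \<in> ?U" using moved[OF i0] top(1) i0 by auto
  then have "y' i0 \<in> X1" using X1' by blast
  then obtain q where "q \<in> X1" and q: "dist (y' i0) q = \<kappa>X * l1"
    using uniform_shapeD(4)[OF shX X1] by blast
  then have "q \<in> convex hull X0" using X1' U by blast
  then have "dist (y' i0) q < \<kappa>X * l0"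
    using dist_halfway_less[OF shX \<kappa>(1) k(1) X0 conjunct1[OF moved[OF i0]]]
      conjunct2[OF moved[OF i0]] by metis
  then show False using q l by simp
qed

lemma no_second_split:
  assumes stay: "\<And>i. i < n \<Longrightarrow> i \<notin> E \<Longrightarrow> y' i = y i"
    and move: "\<And>i. i < n \<Longrightarrow> i \<in> E \<Longrightarrow> \<exists>X Y l. decomposes (configuration n y) X Y l \<and> y i \<in> X
       \<and> y' i = (y i + gravity_center (mset_set X)) / 2 \<and> split_by w c X Y"
    and i0: "i0 < n" "i0 \<in> E"
    and dec1: "decomposes (configuration n y') X1 Y1 l1" and split: "split_by w c X1 Y1"
  shows False
proof -
  obtain X Y l where dec: "decomposes (configuration n y) X Y l" and sp: "split_by w c X Y"
    using move[OF i0] by blast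
  then consider "(\<forall>q\<in>X. c < w \<bullet> q) \<and> (\<forall>q\<in>Y. w \<bullet> q < c)"
    | "(\<forall>q\<in>X. w \<bullet> q < c) \<and> (\<forall>q\<in>Y. c < w \<bullet> q)"
    by (auto simp: split_by_def)
  then show False
  proof cases
    case 1
    then show False
      using no_second_split_top[OF stay move i0 dec _ _ dec1 split] by blast
  next
    case 2
    have "split_by (- w) (- c) X1 Y1" using split by (simp only: split_by_uminus)
    moreover have "\<exists>X Y l. decomposes (configuration n y) X Y l \<and> y i \<in> X
       \<and> y' i = (y i + gravity_center (mset_set X)) / 2 \<and> split_by (- w) (- c) X Y"
      if "i < n" "i \<in> E" for i
      using move[OF that] by (simp only: split_by_uminus)
    ultimately show False
      using 2 no_second_split_top[OF stay _ i0 dec _ _ dec1, of "- w" "- c"] by simp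
  qed
qed

end

text \<open>\<open>E t\<close> stands for the robots activated and not yet crashed at time
  \<open>t\<close>, and \<open>F\<close> for the faulty robots. The assumption \<open>move\<close>
  records only the two kinds of destination in global coordinates, so local systems no longer
  appear.\<close>

locale gathering_run = gathering +
  fixes n :: nat and x :: "nat \<Rightarrow> nat \<Rightarrow> complex" and E :: "nat \<Rightarrow> nat set" and F :: "nat set"
  assumes n: "2 \<le> n"
    and stay: "\<And>t i. i < n \<Longrightarrow> i \<notin> E t \<Longrightarrow> x (Suc t) i = x t i"
    and move: "\<And>t i. i < n \<Longrightarrow> i \<in> E t \<Longrightarrow> x (Suc t) i = gravity_center (configuration n (x t))
       \<or> (\<exists>X Y l. decomposes (configuration n (x t)) X Y l \<and> x t i \<in> X
          \<and> x (Suc t) i = (x t i + gravity_center (mset_set X)) / 2)"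
    and active: "\<And>i. i < n \<Longrightarrow> i \<notin> F \<Longrightarrow> infinite {t. i \<in> E t}"
    and F: "finite F" "card F \<le> 1"
begin

lemma stationary:
  assumes "r \<le> t" "\<And>s. r \<le> s \<Longrightarrow> s < t \<Longrightarrow> E s \<inter> {..<n} = {}" "i < n"
  shows "x t i = x r i"
  using assms
proof (induction t rule: dec_induct)
  case (step t)
  then have "i \<notin> E t" by fastforce
  then show ?case using step stay[of i t] by simp
qed simp

lemma configuration_cong:
  assumes "\<And>i. i < n \<Longrightarrow> y i = z i"
  shows "configuration n y = configuration n z"
  unfolding configuration_def using assms by (intro image_mset_cong) auto

text \<open>The landing at \<open>t\<close> is compared with the last earlier time \<open>r\<close>
  at which some robot acted; \<open>t1\<close> guarantees that there is one. If the landing is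
  shallow, both the configuration at \<open>t\<close> and the movers at \<open>r\<close> split along
  the middle line, contradicting \<open>no_second_split\<close>.\<close>

lemma deep_landing:
  assumes w: "norm w = 1" and sp: "\<And>t. t0 \<le> t \<Longrightarrow> spread n w a b s (x t)"
    and s: "0 < s" "100000 * real n * s \<le> b - a"
    and t1: "t0 \<le> t1" "i1 < n" "i1 \<in> E t1"
    and t: "t1 < t" "i < n" "i \<in> E t"
  shows "a + s \<le> w \<bullet> x (Suc t) i \<and> w \<bullet> x (Suc t) i \<le> b - s"
proof (rule ccontr)
  assume shallow: "\<not> ?thesis"
  let ?c = "(a + b) / 2"
  \<comment> \<open>The center of gravity lands at depth at least \<open>99999 * s\<close>, beyond
    the thresholds \<open>s\<close> and \<open>100 * s\<close> used below.\<close>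
  have gap: "100000 * s \<le> (b - a) / n"
    using s n by (simp add: field_simps)
  have "100000 * s \<le> 100000 * real n * s"
    using s n by simp
  then have big: "100000 * s \<le> b - a"
    using s by linarith
  have spt: "spread n w a b s (x t)" using sp t1 t by simp
  define A where "A = {r. r < t \<and> (\<exists>j<n. j \<in> E r)}"
  have "finite A" "t1 \<in> A" using t1 t by (auto simp: A_def)
  then have "Max A \<in> A" and Max: "\<And>r. r \<in> A \<Longrightarrow> r \<le> Max A" by (auto intro: Max_in)
  then obtain r j0 where r: "r = Max A" "r < t" and j0: "j0 < n" "j0 \<in> E r"
    by (auto simp: A_def)
  have "t1 \<le> r" using Max \<open>t1 \<in> A\<close> r by blast
  have xt: "x t j = x (Suc r) j" if "j < n" for j
  proof (rule stationary)
    fix q assume q: "Suc r \<le> q" "q < t"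
    then have "q \<notin> A" using Max[of q] r(1) by linarith
    then show "E q \<inter> {..<n} = {}" using q by (auto simp: A_def)
  qed (use r that in auto)
  have spr: "spread n w a b s (x r)" using sp t1 \<open>t1 \<le> r\<close> by simp
  have "x (Suc t) i \<noteq> gravity_center (configuration n (x t))"
    using shallow gravity_center_deep[OF spt] gap s(1) by auto
  then obtain X1 Y1 l1 where dec1: "decomposes (configuration n (x t)) X1 Y1 l1" "x t i \<in> X1"
    and xi: "x (Suc t) i = (x t i + gravity_center (mset_set X1)) / 2"
    using move[OF t(2,3)] by blast
  have ends1: "(\<forall>q\<in>X1. b - 100 * s < w \<bullet> q) \<and> (\<forall>q\<in>Y1. w \<bullet> q < a + 100 * s)
    \<or> (\<forall>q\<in>X1. w \<bullet> q < a + 100 * s) \<and> (\<forall>q\<in>Y1. b - 100 * s < w \<bullet> q)"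
    using shallow big s unfolding xi by (intro halfway_near_end[OF w spt dec1]) auto
  then have split1: "split_by w ?c X1 Y1"
    using big s by (intro split_byI) auto
  \<comment> \<open>At time \<open>t\<close> every robot is within \<open>100 * s\<close> of an end,
    so every landing of step \<open>r\<close> was shallow on that scale.\<close>
  have not_deep: "\<not> (a + 100 * s \<le> w \<bullet> x t j \<and> w \<bullet> x t j \<le> b - 100 * s)" if "j < n" for j
  proof -
    have "x t j \<in> X1 \<union> Y1" using decomposes_set[OF dec1(1)] that by blast
    then show ?thesis using ends1 by fastforce
  qed
  have "\<exists>X Y l. decomposes (configuration n (x r)) X Y l \<and> x r j \<in> X
       \<and> x (Suc r) j = (x r j + gravity_center (mset_set X)) / 2 \<and> split_by w ?c X Y"
    if j: "j < n" "j \<in> E r" for j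
  proof -
    have nd: "\<not> (a + 100 * s \<le> w \<bullet> x (Suc r) j \<and> w \<bullet> x (Suc r) j \<le> b - 100 * s)"
      using not_deep[OF j(1)] xt[OF j(1)] by simp
    then have "x (Suc r) j \<noteq> gravity_center (configuration n (x r))"
      using gravity_center_deep[OF spr] gap s(1) by auto
    then obtain X Y l where dec: "decomposes (configuration n (x r)) X Y l" "x r j \<in> X"
      and xj: "x (Suc r) j = (x r j + gravity_center (mset_set X)) / 2"
      using move[OF j] by blast
    \<comment> \<open>The same lemma on the scale \<open>100 * s\<close>. The result
      \<open>10000 * s\<close> is still less than half of \<open>b - a\<close>, so the middle line
      separates the figures.\<close>
    have "(\<forall>q\<in>X. b - 100 * (100 * s) < w \<bullet> q) \<and> (\<forall>q\<in>Y. w \<bullet> q < a + 100 * (100 * s))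
      \<or> (\<forall>q\<in>X. w \<bullet> q < a + 100 * (100 * s)) \<and> (\<forall>q\<in>Y. b - 100 * (100 * s) < w \<bullet> q)"
      using nd big s unfolding xj by (intro halfway_near_end[OF w spr dec]) auto
    then have "split_by w ?c X Y"
      using big s by (intro split_byI) auto
    then show ?thesis using dec xj by blast
  qed
  moreover have "decomposes (configuration n (x (Suc r))) X1 Y1 l1"
    using dec1(1) configuration_cong[of "x t" "x (Suc r)"] xt by simp
  ultimately show False
    using no_second_split[of n "E r" "x (Suc r)" "x r", OF stay _ j0] split1 by blast
qed

text \<open>From some time on, all robots outside \<open>F\<close> keep distance \<open>s\<close>
  from both ends. The ends must then be occupied by robots of \<open>F\<close>, hence by one and the
  same robot, which is impossible for \<open>a < b\<close>.\<close>

lemma no_spread: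
  assumes w: "norm w = 1" and ab: "a < b"
    and sp: "\<And>e. 0 < e \<Longrightarrow> \<forall>\<^sub>F t in sequentially. spread n w a b e (x t)"
  shows False
proof -
  define s where "s = (b - a) / (100000 * real n)"
  have s: "0 < s" "100000 * real n * s \<le> b - a" using ab n by (auto simp: s_def)
  obtain t0 where t0: "\<And>t. t0 \<le> t \<Longrightarrow> spread n w a b s (x t)"
    using sp[OF s(1)] unfolding eventually_sequentially by blast
  \<comment> \<open>Two robots and at most one fault leave a correct robot, whose activation
    supplies the earlier action that \<open>deep_landing\<close> requires.\<close>
  have "\<not> {..<n} \<subseteq> F"
    using card_mono[OF F(1), of "{..<n}"] F n by auto
  then obtain i1 where i1: "i1 < n" "i1 \<notin> F" by auto
  then obtain t1 where t1: "t0 \<le> t1" "i1 \<in> E t1"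
    using active unfolding infinite_nat_iff_unbounded_le by blast
  have "\<forall>\<^sub>F t in sequentially. a + s \<le> w \<bullet> x t i \<and> w \<bullet> x t i \<le> b - s"
    if i: "i < n" "i \<notin> F" for i
  proof -
    obtain t2 where t2: "t1 < t2" "i \<in> E t2"
      using active[OF i] unfolding infinite_nat_iff_unbounded by blast
    \<comment> \<open>After its first activation later than \<open>t1\<close>, robot
      \<open>i\<close> either rests or lands deep again.\<close>
    have "a + s \<le> w \<bullet> x t i \<and> w \<bullet> x t i \<le> b - s" if "Suc t2 \<le> t" for t
      using that
    proof (induction t rule: dec_induct)
      case base
      show ?case by (rule deep_landing[OF w t0 s t1(1) i1(1) t1(2) t2(1) i(1) t2(2)])
    next
      case (step t)
      show ?case
      proof (cases "i \<in> E t")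
        case True
        then show ?thesis
          using step t2 by (intro deep_landing[OF w t0 s t1(1) i1(1) t1(2) _ i(1)]) auto
      qed (use step stay[OF i(1)] in simp)
    qed
    then show ?thesis unfolding eventually_sequentially by blast
  qed
  then have "\<forall>\<^sub>F t in sequentially. \<forall>i\<in>{..<n} - F. a + s \<le> w \<bullet> x t i \<and> w \<bullet> x t i \<le> b - s"
    by (intro eventually_ball_finite) auto
  moreover have "\<forall>\<^sub>F t in sequentially. spread n w a b s (x t)" using sp s by blast
  ultimately have "\<forall>\<^sub>F t in sequentially. spread n w a b s (x t) \<and>
      (\<forall>i\<in>{..<n} - F. a + s \<le> w \<bullet> x t i \<and> w \<bullet> x t i \<le> b - s)"
    by eventually_elim blast
  then obtain t where t: "spread n w a b s (x t)"
    "\<And>i. i < n \<Longrightarrow> i \<notin> F \<Longrightarrow> a + s \<le> w \<bullet> x t i \<and> w \<bullet> x t i \<le> b - s"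
    unfolding eventually_sequentially by auto
  obtain i j where ij: "i < n" "w \<bullet> x t i \<le> a" "j < n" "b \<le> w \<bullet> x t j"
    using t(1) by (auto simp: spread_def)
  then have "i \<in> F" "j \<in> F" using t(2)[of i] t(2)[of j] s by fastforce+
  then have "i = j" using F card_le_Suc0_iff_eq[of F] by simp
  then show False using ij ab by simp
qed

lemma step_in_hull:
  assumes "i < n"
  shows "x (Suc t) i \<in> convex hull (x t ` {..<n})"
proof (cases "i \<in> E t")
  case True
  then consider "x (Suc t) i = gravity_center (configuration n (x t))"
    | X Y l where "decomposes (configuration n (x t)) X Y l" "x t i \<in> X"
        "x (Suc t) i = (x t i + gravity_center (mset_set X)) / 2"
    using move[OF assms] by blast
  then show ?thesis
  proof cases
    case 1
    have "configuration n (x t) \<noteq> {#}"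
      using n by (simp add: configuration_def mset_set_empty_iff lessThan_empty_iff)
    then show ?thesis
      using gravity_center_in_convex_hull[of "configuration n (x t)"] by (simp add: 1)
  next
    case (2 X Y l)
    then have "convex hull X \<subseteq> convex hull (x t ` {..<n})"
      by (intro hull_mono) (auto simp: decomposes_set)
    moreover have "x (Suc t) i \<in> convex hull X"
      unfolding 2(3) using halfway_in_hull[OF decomposes_finite(1)[OF 2(1)] 2(2)] .
    ultimately show ?thesis by blast
  qed
qed (use stay assms in \<open>auto intro: hull_inc\<close>)

text \<open>Robots never leave the hull of the configuration, so the extreme projections are
  monotone and converge. \<open>no_spread\<close> makes their limits equal, and every projection is
  squeezed between them.\<close>

lemma directional_convergence:
  assumes w: "norm w = 1"
  shows "\<exists>c. \<forall>i<n. (\<lambda>t. w \<bullet> x t i) \<longlonglongrightarrow> c"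
proof -
  define S where "S t = (\<lambda>i. w \<bullet> x t i) ` {..<n}" for t
  have S: "finite (S t)" "S t \<noteq> {}" for t
    using n by (auto simp: S_def lessThan_empty_iff)
  define lo hi where "lo t = Min (S t)" and "hi t = Max (S t)" for t
  have bnd: "lo t \<le> w \<bullet> x t i" "w \<bullet> x t i \<le> hi t" if "i < n" for t i
    using that S by (auto simp: lo_def hi_def S_def)
  have att: "\<exists>i<n. lo t = w \<bullet> x t i" "\<exists>i<n. hi t = w \<bullet> x t i" for t
    using Min_in[OF S] Max_in[OF S] by (auto simp: lo_def hi_def S_def)
  have Suc: "lo t \<le> w \<bullet> x (Suc t) i" "w \<bullet> x (Suc t) i \<le> hi t" if "i < n" for t i
  proof -
    have "convex hull (x t ` {..<n}) \<subseteq> {z. w \<bullet> z \<ge> lo t}"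
      "convex hull (x t ` {..<n}) \<subseteq> {z. w \<bullet> z \<le> hi t}"
      using bnd by (intro hull_minimal; auto intro: convex_halfspace_ge convex_halfspace_le)+
    then show "lo t \<le> w \<bullet> x (Suc t) i" "w \<bullet> x (Suc t) i \<le> hi t"
      using step_in_hull[OF that] by auto
  qed
  have "incseq lo" "decseq hi"
    using Suc att by (intro incseq_SucI decseq_SucI; metis)+
  have lohi: "lo t \<le> hi t" for t using bnd[of 0 t] n by simp
  have "lo t \<le> hi 0" "lo 0 \<le> hi t" for t
    using lohi[of t] incseqD[OF \<open>incseq lo\<close>, of 0 t] decseqD[OF \<open>decseq hi\<close>, of 0 t] by auto
  then obtain a b where a: "lo \<longlonglongrightarrow> a" "\<And>t. lo t \<le> a" and b: "hi \<longlonglongrightarrow> b" "\<And>t. b \<le> hi t"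
    using incseq_convergent[OF \<open>incseq lo\<close>] decseq_convergent[OF \<open>decseq hi\<close>] by metis
  have "a \<le> b" using LIMSEQ_le[OF a(1) b(1)] lohi by blast
  moreover have "\<not> a < b"
  proof
    assume "a < b"
    have "\<forall>\<^sub>F t in sequentially. spread n w a b e (x t)" if "0 < e" for e
    proof -
      have "\<forall>\<^sub>F t in sequentially. a - e < lo t" "\<forall>\<^sub>F t in sequentially. hi t < b + e"
        using order_tendstoD(1)[OF a(1)] order_tendstoD(2)[OF b(1)] that by auto
      then show ?thesis
      proof eventually_elim
        case (elim t)
        have "a - e \<le> w \<bullet> x t i \<and> w \<bullet> x t i \<le> b + e" if "i < n" for i
          using elim bnd[OF that, of t] by linarith
        moreover have "\<exists>i<n. w \<bullet> x t i \<le> a" "\<exists>i<n. b \<le> w \<bullet> x t i"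
          using att[of t] a(2)[of t] b(2)[of t] by metis+
        ultimately show ?case by (simp add: spread_def)
      qed
    qed
    then show False using no_spread[OF w \<open>a < b\<close>] by blast
  qed
  ultimately have "a = b" by simp
  have "(\<lambda>t. w \<bullet> x t i) \<longlonglongrightarrow> a" if "i < n" for i
    using bnd that a(1) b(1) \<open>a = b\<close>
    by (intro tendsto_sandwich[of lo "\<lambda>t. w \<bullet> x t i" sequentially hi]) auto
  then show ?thesis by blast
qed

lemma convergence: "\<exists>p. \<forall>i<n. (\<lambda>t. x t i) \<longlonglongrightarrow> p"
proof -
  obtain c d where c: "\<And>i. i < n \<Longrightarrow> (\<lambda>t. 1 \<bullet> x t i) \<longlonglongrightarrow> c"
    and d: "\<And>i. i < n \<Longrightarrow> (\<lambda>t. \<i> \<bullet> x t i) \<longlonglongrightarrow> d"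
    using directional_convergence[of 1] directional_convergence[of \<i>] by auto
  have "(\<lambda>t. x t i) \<longlonglongrightarrow> Complex c d" if "i < n" for i
    using c[OF that] d[OF that] by (simp add: tendsto_complex_iff inner_complex_def)
  then show ?thesis by blast
qed

end

section \<open>The target functions in global coordinates\<close>

text \<open>The part of \<open>Psi\<close> that does not mention the origin and is therefore
  preserved by similarities.\<close>

definition shape_pair :: "complex multiset \<Rightarrow> complex set \<Rightarrow> complex set \<Rightarrow> bool" where
  "shape_pair P T S \<longleftrightarrow> P = mset_set T + mset_set S \<and> (\<exists>l. equilateral_triangle l T \<and> square l S)
     \<and> convex hull T \<inter> convex hull S = {}"

lemma equilateral_triangle_card: "equilateral_triangle l T \<Longrightarrow> finite T \<and> card T = 3"
  using uniform_shapeD(1)[OF equilateral_triangle_uniform] by (metis card_ge_0_finite zero_less_numeral)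

lemma square_card: "square l S \<Longrightarrow> finite S \<and> card S = 4"
  using uniform_shapeD(1)[OF square_uniform] by (metis card_ge_0_finite zero_less_numeral)

lemma Psi_iff_shape_pair: "Psi P T S \<longleftrightarrow> 0 \<in># P \<and> shape_pair P T S"
proof -
  have "size P = 7" if "shape_pair P T S"
    using that equilateral_triangle_card square_card by (fastforce simp: shape_pair_def)
  then show ?thesis unfolding Psi_def shape_pair_def by blast
qed

lemma shape_pair_subset:
  assumes "shape_pair P T S"
  shows "finite T" "finite S" "T \<subseteq> set_mset P" "S \<subseteq> set_mset P"
  using assms equilateral_triangle_card square_card by (auto simp: shape_pair_def)

section \<open>Figures and target functions under similarities\<close>

lemma inj_to_global: "u \<noteq> 0 \<Longrightarrow> inj_on (to_global u p) A"
  by (auto simp: to_global_def inj_on_def)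

lemma inv_to_global:
  assumes "u \<noteq> 0"
  shows "inv (to_global u p) = to_global (1 / u) (- p / u)"
  using assms by (intro inv_equality) (auto simp: to_global_def field_simps)

lemma dist_to_global: "dist (to_global u p a) (to_global u p b) = norm u * dist a b"
  by (simp add: to_global_def dist_norm flip: right_diff_distrib norm_mult)

lemma orthogonal_to_global:
  assumes "orthogonal (a - b) (c - d)"
  shows "orthogonal (to_global u p a - to_global u p b) (to_global u p c - to_global u p d)"
proof -
  have "(u * x) \<bullet> (u * y) = (norm u)\<^sup>2 * (x \<bullet> y)" for x y
    unfolding cmod_power2 by (simp add: inner_complex_def algebra_simps power2_eq_square)
  moreover have "to_global u p x - to_global u p y = u * (x - y)" for x y
    by (simp add: to_global_def algebra_simps)
  ultimately show ?thesis using assms by (simp add: orthogonal_def)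
qed

lemma convex_hull_to_global: "convex hull (to_global u p ` A) = to_global u p ` (convex hull A)"
proof -
  have "to_global u p ` B = (+) p ` ((*) u) ` B" for B
    by (auto simp: to_global_def image_iff)
  then show ?thesis
    by (simp add: convex_hull_translation convex_hull_linear_image)
qed

lemma equilateral_triangle_to_global:
  assumes "u \<noteq> 0" "equilateral_triangle l T"
  shows "equilateral_triangle (norm u * l) (to_global u p ` T)"
proof -
  obtain a b c where "0 < l" "T = {a, b, c}" "dist a b = l" "dist b c = l" "dist c a = l"
    using assms unfolding equilateral_triangle_def by blast
  then show ?thesis
    using assms(1) unfolding equilateral_triangle_def
    by (intro conjI exI[of _ "to_global u p a"] exI[of _ "to_global u p b"] exI[of _ "to_global u p c"])
      (simp_all add: dist_to_global)
qed

lemma square_to_global: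
  assumes "u \<noteq> 0" "square l S"
  shows "square (norm u * l) (to_global u p ` S)"
proof -
  obtain a b c d where "0 < l" "S = {a, b, c, d}"
    "dist a b = l" "dist b c = l" "dist c d = l" "dist d a = l"
    "orthogonal (d - a) (b - a)" "orthogonal (a - b) (c - b)"
    "orthogonal (b - c) (d - c)" "orthogonal (c - d) (a - d)"
    using assms unfolding square_def by blast
  then show ?thesis
    using assms(1) unfolding square_def
    by (intro conjI exI[of _ "to_global u p a"] exI[of _ "to_global u p b"] exI[of _ "to_global u p c"]
        exI[of _ "to_global u p d"] orthogonal_to_global)
      (simp_all add: dist_to_global)
qed

lemma shape_pair_to_global:
  assumes "u \<noteq> 0" "shape_pair P T S"
  shows "shape_pair (image_mset (to_global u p) P) (to_global u p ` T) (to_global u p ` S)"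
  using assms equilateral_triangle_to_global[of u _ T p] square_to_global[of u _ S p]
    image_Int[OF inj_to_global[of u p UNIV], of "convex hull T" "convex hull S"]
  unfolding shape_pair_def
  by (auto simp: image_mset_mset_set inj_to_global convex_hull_to_global)

lemma gravity_center_to_global:
  assumes "P \<noteq> {#}"
  shows "gravity_center (image_mset (to_global u p) P) = to_global u p (gravity_center P)"
proof -
  have "sum_mset (image_mset (to_global u p) P) = of_nat (size P) * p + u * sum_mset P"
    by (induction P) (simp_all add: to_global_def algebra_simps)
  moreover have "size P \<noteq> 0" using assms by simp
  ultimately show ?thesis
    by (simp add: gravity_center_def to_global_def add_divide_distrib)
qed

text \<open>Common form of \<open>phi_T\<close> and \<open>phi_S\<close>: \<open>Q P X\<close>
  singles out the figures \<open>X\<close> of \<open>P\<close> that are to be halved.\<close>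

definition halving_rule :: "(complex multiset \<Rightarrow> complex set \<Rightarrow> bool) \<Rightarrow> target_fun" where
  "halving_rule Q P = (if 0 \<notin># P then None
     else if \<exists>X. Q P X \<and> 0 \<in> X then Some (gravity_center (mset_set (SOME X. Q P X \<and> 0 \<in> X)) / 2)
     else Some (gravity_center P))"

definition covariant :: "(complex multiset \<Rightarrow> complex set \<Rightarrow> bool) \<Rightarrow> bool" where
  "covariant Q \<longleftrightarrow> (\<forall>P X. Q P X \<longrightarrow> finite X \<and> X \<subseteq> set_mset P \<and>
     (\<forall>u p. u \<noteq> 0 \<longrightarrow> Q (image_mset (to_global u p) P) (to_global u p ` X)))"

lemma phi_T_eq: "phi_T = halving_rule (\<lambda>P T. \<exists>S. shape_pair P T S)"
  by (rule ext) (auto simp: phi_T_def halving_rule_def Psi_iff_shape_pair)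

lemma phi_S_eq: "phi_S = halving_rule (\<lambda>P S. \<exists>T. shape_pair P T S)"
  by (rule ext) (auto simp: phi_S_def halving_rule_def Psi_iff_shape_pair)

lemma covariant_triangle: "covariant (\<lambda>P T. \<exists>S. shape_pair P T S)"
  using shape_pair_to_global shape_pair_subset unfolding covariant_def by blast

lemma covariant_square: "covariant (\<lambda>P S. \<exists>T. shape_pair P T S)"
  using shape_pair_to_global shape_pair_subset unfolding covariant_def by blast

lemma halving_rule_cases:
  assumes "covariant Q" "0 \<in># P"
  obtains X where "Q P X" "0 \<in> X" "halving_rule Q P = Some (gravity_center (mset_set X) / 2)"
  | "\<nexists>X. Q P X \<and> 0 \<in> X" "halving_rule Q P = Some (gravity_center P)"
proof (cases "\<exists>X. Q P X \<and> 0 \<in> X")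
  case True
  then show ?thesis
    using assms someI_ex[OF True] that(1)[of "SOME X. Q P X \<and> 0 \<in> X"] by (simp add: halving_rule_def)
next
  case False
  then have "halving_rule Q P = Some (gravity_center P)"
    using assms by (simp only: halving_rule_def if_False if_not_P simp_thms)
  then show ?thesis using False that(2) by blast
qed

text \<open>Covariance carries the figure seen locally to a global figure containing
  \<open>p\<close>. Conversely, a global figure containing \<open>p\<close> would be seen locally,
  so the default case occurs only if there is none.\<close>

lemma move_result_halving_rule:
  assumes cov: "covariant Q" and u: "u \<noteq> 0" and p: "p \<in># P"
  obtains X where "Q P X" "p \<in> X"
    "move_result (halving_rule Q) u p P = (p + gravity_center (mset_set X)) / 2"
  | "\<nexists>X. Q P X \<and> p \<in> X" "move_result (halving_rule Q) u p P = gravity_center P"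
proof -
  let ?h = "to_global u p"
  define P' where "P' = image_mset (inv ?h) P"
  have inv: "?h (inv ?h z) = z" "inv ?h (?h z) = z" for z
    using u by (simp_all add: inv_to_global to_global_def field_simps)
  have h0: "?h 0 = p" by (simp add: to_global_def)
  have P: "P = image_mset ?h P'" by (simp add: P'_def image_mset.compositionality comp_def inv)
  have P0: "0 \<in># P'" using p inv(2)[of 0] h0 by (auto simp: P'_def image_iff intro!: bexI[of _ p])
  show ?thesis
  proof (rule halving_rule_cases[OF cov P0])
    fix X assume X: "Q P' X" "0 \<in> X"
      and eq: "halving_rule Q P' = Some (gravity_center (mset_set X) / 2)"
    have fin: "finite X" "X \<noteq> {}" using cov X by (auto simp: covariant_def)
    have "Q P (?h ` X)" using cov X u unfolding covariant_def P by blast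
    moreover have "p \<in> ?h ` X" using X(2) h0 by force
    moreover have "gravity_center (mset_set (?h ` X)) = ?h (gravity_center (mset_set X))"
      using gravity_center_to_global[of "mset_set X" u p] fin u
      by (simp add: image_mset_mset_set inj_to_global mset_set_empty_iff)
    \<comment> \<open>Halving towards the local origin becomes halving towards \<open>p\<close>:
      \<open>p + u * (g / 2)\<close> is the midpoint of \<open>p\<close> and
      \<open>p + u * g\<close>.\<close>
    then have "move_result (halving_rule Q) u p P = (p + gravity_center (mset_set (?h ` X))) / 2"
      using eq by (simp add: move_result_def to_global_def field_simps flip: P'_def)
    ultimately show thesis using that(1) by blast
  next
    assume none: "\<nexists>X. Q P' X \<and> 0 \<in> X" and eq: "halving_rule Q P' = Some (gravity_center P')"
    have "P' \<noteq> {#}" using P0 by auto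
    then have "move_result (halving_rule Q) u p P = gravity_center P"
      using eq gravity_center_to_global[of P' u p] by (simp add: move_result_def P flip: P'_def)
        (simp add: P'_def[symmetric] flip: P)
    moreover have "\<not> (Q P X \<and> p \<in> X)" for X
    proof
      assume X: "Q P X \<and> p \<in> X"
      then have "Q P' (inv ?h ` X)"
        using cov u unfolding covariant_def P'_def inv_to_global[OF u] by simp
      moreover have "0 \<in> inv ?h ` X" using X inv(2)[of 0] h0 by force
      ultimately show False using none by blast
    qed
    ultimately show thesis using that(2) by blast
  qed
qed

lemma (in gathering) compatible_halving_rule:
  assumes cov: "covariant Q" and Q: "\<And>P X. Q P X \<Longrightarrow> \<exists>Y l. decomposes P X Y l"
  shows "compatible_FC1_PO {halving_rule Q}"
  unfolding compatible_FC1_PO_def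
proof (intro allI impI, elim conjE)
  fix n :: nat and \<phi> :: "nat \<Rightarrow> target_fun" and u act crash x
  assume n: "2 \<le> n" and \<phi>: "\<forall>i<n. \<phi> i \<in> {halving_rule Q}" and u: "\<forall>i<n. u i \<noteq> 0"
    and fair: "fair n act" and F: "card (faulty n crash) \<le> 1" and ex: "execution n \<phi> u act crash x"
  interpret gathering_run shX shY \<kappa>X \<kappa>Y kX kY n x "\<lambda>t. {i \<in> act t. enat t < crash i}" "faulty n crash"
  proof
    fix t i assume i: "i < n"
    show "x (Suc t) i = x t i" if "i \<notin> {i \<in> act t. enat t < crash i}"
      using ex that i by (auto simp: execution_def)
    assume "i \<in> {i \<in> act t. enat t < crash i}"
    then have "x (Suc t) i = move_result (halving_rule Q) (u i) (x t i) (configuration n (x t))"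
      using ex i \<phi> by (auto simp: execution_def)
    moreover have "x t i \<in># configuration n (x t)" using i by simp
    ultimately show "x (Suc t) i = gravity_center (configuration n (x t)) \<or>
      (\<exists>X Y l. decomposes (configuration n (x t)) X Y l \<and> x t i \<in> X \<and>
        x (Suc t) i = (x t i + gravity_center (mset_set X)) / 2)"
      using move_result_halving_rule[OF cov, of "u i" "x t i" "configuration n (x t)"] u i Q by metis
  next
    fix i assume "i < n" "i \<notin> faulty n crash"
    then show "infinite {t. i \<in> {i \<in> act t. enat t < crash i}}"
      using fair by (simp add: faulty_def fair_def)
  qed (use n F in \<open>auto simp: faulty_def\<close>)
  show "\<exists>p. \<forall>i<n. (\<lambda>t. x t i) \<longlonglongrightarrow> p" by (rule convergence)
qed

lemma compatible_phi_T: "compatible_FC1_PO {phi_T}"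
proof -
  interpret gathering equilateral_triangle square 1 "sqrt 2" 3 4
    using equilateral_triangle_uniform square_uniform
    by unfold_locales (auto intro: real_le_lsqrt)
  show ?thesis
    unfolding phi_T_eq using covariant_triangle
    by (rule compatible_halving_rule) (auto simp: decomposes_def shape_pair_def)
qed

lemma compatible_phi_S: "compatible_FC1_PO {phi_S}"
proof -
  interpret gathering square equilateral_triangle "sqrt 2" 1 4 3
    using equilateral_triangle_uniform square_uniform by unfold_locales auto
  show ?thesis
    unfolding phi_S_eq using covariant_square
    by (rule compatible_halving_rule) (auto simp: decomposes_def shape_pair_def add.commute)
qed

section \<open>Two distant figures\<close>

text \<open>Side \<open>2 * s\<close> and center 0, so that halving towards the center replaces
  \<open>s\<close> by \<open>s / 2\<close>. The square \<open>sqr c s\<close> has the same side and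
  center \<open>c\<close>.\<close>

definition tri :: "real \<Rightarrow> complex set" where
  "tri s = {Complex (- s) (- s / sqrt 3), Complex s (- s / sqrt 3), Complex 0 (2 * s / sqrt 3)}"

definition sqr :: "real \<Rightarrow> real \<Rightarrow> complex set" where
  "sqr c s = {Complex (c - s) (- s), Complex (c + s) (- s), Complex (c + s) s, Complex (c - s) s}"

text \<open>Robots 0 to 2 occupy the triangle, robots 3 to 6 the square.\<close>

definition vertex :: "real \<Rightarrow> real \<Rightarrow> nat \<Rightarrow> complex" where
  "vertex c s i = [Complex (- s) (- s / sqrt 3), Complex s (- s / sqrt 3), Complex 0 (2 * s / sqrt 3),
     Complex (c - s) (- s), Complex (c + s) (- s), Complex (c + s) s, Complex (c - s) s] ! i"

lemma dist_complexI:
  assumes "(Re a - Re b)\<^sup>2 + (Im a - Im b)\<^sup>2 = l\<^sup>2" "0 \<le> l"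
  shows "dist a b = l"
  using assms by (simp add: dist_norm cmod_def)

lemma equilateral_triangle_tri:
  assumes "0 < s"
  shows "equilateral_triangle (2 * s) (tri s)"
  unfolding equilateral_triangle_def tri_def
  by (intro conjI exI[of _ "Complex (- s) (- s / sqrt 3)"] exI[of _ "Complex s (- s / sqrt 3)"]
      exI[of _ "Complex 0 (2 * s / sqrt 3)"] refl dist_complexI)
    (use assms in \<open>simp_all add: power_divide power_mult_distrib flip: add_divide_distrib diff_divide_distrib\<close>)

lemma square_sqr:
  assumes "0 < s"
  shows "square (2 * s) (sqr c s)"
  unfolding square_def sqr_def
  by (intro conjI exI[of _ "Complex (c - s) (- s)"] exI[of _ "Complex (c + s) (- s)"]
      exI[of _ "Complex (c + s) s"] exI[of _ "Complex (c - s) s"] refl dist_complexI)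
    (use assms in \<open>simp_all add: orthogonal_def inner_complex_def\<close>)

lemma Re_tri: "p \<in> tri s \<Longrightarrow> 0 < s \<Longrightarrow> \<bar>Re p\<bar> \<le> s"
  by (auto simp: tri_def)

lemma Re_sqr: "p \<in> sqr c s \<Longrightarrow> 0 < s \<Longrightarrow> \<bar>Re p - c\<bar> \<le> s"
  by (auto simp: sqr_def)

lemma card_tri_sqr:
  assumes "0 < s"
  shows "finite (tri s)" "card (tri s) = 3" "finite (sqr c s)" "card (sqr c s) = 4"
  using equilateral_triangle_card[OF equilateral_triangle_tri] square_card[OF square_sqr] assms
  by auto

lemma gravity_center_tri:
  assumes "0 < s"
  shows "gravity_center (mset_set (tri s)) = 0"
  unfolding gravity_center_mset_set card_tri_sqr(2)[OF assms]
  using assms by (simp add: tri_def complex_eq_iff)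

lemma gravity_center_sqr:
  assumes "0 < s"
  shows "gravity_center (mset_set (sqr c s)) = c"
  unfolding gravity_center_mset_set card_tri_sqr(4)[OF assms]
  using assms by (simp add: sqr_def complex_eq_iff)

lemma configuration_vertex:
  assumes "0 < s"
  shows "configuration 7 (vertex c s) = mset_set (tri s) + mset_set (sqr c s)"
proof -
  have "{..<7::nat} = {0, 1, 2, 3, 4, 5, 6}" by auto
  then show ?thesis
    using assms by (simp add: configuration_def vertex_def tri_def sqr_def)
qed

lemma shape_pair_vertex:
  assumes "0 < s" "2 * s < c"
  shows "shape_pair (configuration 7 (vertex c s)) (tri s) (sqr c s)"
proof -
  have "tri s \<subseteq> {z. Re z < c / 2}" "sqr c s \<subseteq> {z. c / 2 < Re z}"
    using assms Re_tri[of _ s] Re_sqr[of _ c s] by fastforce+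
  then have "convex hull tri s \<subseteq> {z. Re z < c / 2}" "convex hull sqr c s \<subseteq> {z. c / 2 < Re z}"
    using hull_minimal convex_halfspace_Re_lt convex_halfspace_Re_gt by blast+
  then have "convex hull tri s \<inter> convex hull sqr c s = {}" by fastforce
  then show ?thesis
    unfolding shape_pair_def configuration_vertex[OF assms(1)]
    using equilateral_triangle_tri square_sqr assms by blast
qed

section \<open>Uniqueness of the decomposition for distant figures\<close>

lemma square_dist_ge:
  assumes "square l S" "p \<in> S" "q \<in> S" "p \<noteq> q"
  shows "l \<le> dist p q"
proof -
  obtain a b c d where l: "0 < l" and X: "S = {a, b, c, d}"
    and d: "dist a b = l" "dist b c = l" "dist c d = l" "dist d a = l"
    and o: "orthogonal (d - a) (b - a)" "orthogonal (a - b) (c - b)" "orthogonal (b - c) (d - c)"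
    using assms(1) unfolding square_def by blast
  have "dist a c = sqrt 2 * l" "dist b d = sqrt 2 * l"
    by (rule dist_right_angle[OF d(1,2) l o(2)], rule dist_right_angle[OF d(2,3) l o(3)])
  moreover have "l \<le> sqrt 2 * l" using l by simp
  ultimately have "l \<le> dist a b" "l \<le> dist b c" "l \<le> dist c d" "l \<le> dist d a" "l \<le> dist a c" "l \<le> dist b d"
    using d by linarith+
  then show ?thesis
    using assms(2-4) unfolding X by (elim insertE; simp add: dist_commute)
qed

text \<open>A square with vertices in both figures has diameter at least 8 and hence side above 3.
  Yet any third vertex shares a figure with one of the two and is within 3 of it. So the square lies
  in one figure, and by counting it is \<open>sqr c s\<close>, which also determines the
  triangle.\<close>

lemma shape_pair_vertex_unique:
  assumes s: "0 < s" "s \<le> 1" and c: "10 \<le> c"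
    and pair: "shape_pair (configuration 7 (vertex c s)) T S"
  shows "T = tri s \<and> S = sqr c s"
proof -
  have conf: "mset_set (tri s) + mset_set (sqr c s) = mset_set T + mset_set S"
    using pair by (simp add: shape_pair_def configuration_vertex[OF s(1)])
  obtain l where S: "square l S" using pair by (auto simp: shape_pair_def)
  note fin = shape_pair_subset(1,2)[OF pair] and fin' = card_tri_sqr[OF s(1)]
  have cS: "card S = 4" using square_card[OF S] by simp
  have sub: "S \<subseteq> tri s \<union> sqr c s"
    using arg_cong[OF conf, of set_mset] fin fin' by auto
  have "sqrt 2 \<le> 3 / 2" by (rule real_le_lsqrt) (simp_all add: power2_eq_square)
  then have sqrt2: "sqrt 2 * r \<le> 3 / 2 * r" if "0 \<le> r" for r
    using that by (intro mult_right_mono)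
  have near_tri: "dist p q \<le> 3" if "p \<in> tri s" "q \<in> tri s" for p q
    using uniform_shapeD(3)[OF equilateral_triangle_uniform equilateral_triangle_tri[OF s(1)] that] s
    by simp
  have near_sqr: "dist p q \<le> 3" if "p \<in> sqr c s" "q \<in> sqr c s" for p q
    using uniform_shapeD(3)[OF square_uniform square_sqr[OF s(1)] that] sqrt2[of "2 * s"] s
    by linarith
  have far: "8 \<le> dist p q" if "p \<in> tri s" "q \<in> sqr c s" for p q
  proof -
    have "8 \<le> \<bar>Re (p - q)\<bar>" using Re_tri[OF that(1) s(1)] Re_sqr[OF that(2) s(1)] s c by simp
    then show ?thesis using abs_Re_le_cmod[of "p - q"] by (simp add: dist_norm)
  qed
  have "\<not> (p \<in> S \<inter> tri s \<and> q \<in> S \<inter> sqr c s)" for p q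
  proof
    assume pq: "p \<in> S \<inter> tri s \<and> q \<in> S \<inter> sqr c s"
    have "8 \<le> sqrt 2 * l"
      using far[of p q] uniform_shapeD(3)[OF square_uniform S, of p q] pq by auto
    then have "3 < l" using sqrt2[of l] uniform_shapeD(2)[OF square_uniform S] by linarith
    have "\<not> S \<subseteq> {p, q}"
      using card_mono[of "{p, q}" S] cS card_insert_le_m1[of 2 "{q}" p] by auto
    then obtain r where r: "r \<in> S" "r \<noteq> p" "r \<noteq> q" by blast
    then have "dist r p \<le> 3 \<or> dist r q \<le> 3" using near_tri near_sqr sub pq by blast
    moreover have "l \<le> dist r p" "l \<le> dist r q" using square_dist_ge[OF S] r pq by auto
    ultimately show False using \<open>3 < l\<close> by linarith
  qed
  then have "S \<subseteq> tri s \<or> S \<subseteq> sqr c s" using sub by blast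
  moreover have "\<not> S \<subseteq> tri s" using card_mono[of "tri s" S] fin' cS by auto
  ultimately have "S = sqr c s" using card_subset_eq[of "sqr c s" S] fin'(3,4) cS by simp
  then have "mset_set (tri s) = mset_set T" using conf by simp
  then have "T = tri s" using fin fin' by (metis finite_set_mset_mset_set)
  then show ?thesis using \<open>S = sqr c s\<close> by simp
qed

lemma move_result_phi_T_vertex:
  assumes "0 < s" "s \<le> 1" "10 \<le> c" "u \<noteq> 0" "p \<in> tri s"
  shows "move_result phi_T u p (configuration 7 (vertex c s)) = p / 2"
proof -
  let ?P = "configuration 7 (vertex c s)"
  have pair: "shape_pair ?P (tri s) (sqr c s)" using assms by (intro shape_pair_vertex) auto
  have p: "p \<in># ?P" using shape_pair_subset(3)[OF pair] assms(5) by blast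
  show ?thesis
    unfolding phi_T_eq
  proof (rule move_result_halving_rule[OF covariant_triangle assms(4) p])
    fix X assume "\<exists>S. shape_pair ?P X S" and eq: "move_result (halving_rule (\<lambda>P T. \<exists>S. shape_pair P T S)) u p ?P
      = (p + gravity_center (mset_set X)) / 2"
    then have "X = tri s" using shape_pair_vertex_unique[OF assms(1-3)] by blast
    then show "move_result (halving_rule (\<lambda>P T. \<exists>S. shape_pair P T S)) u p ?P = p / 2"
      by (simp add: eq gravity_center_tri[OF assms(1)])
  qed (use pair assms(5) in blast)
qed

lemma move_result_phi_S_vertex:
  assumes "0 < s" "s \<le> 1" "10 \<le> c" "u \<noteq> 0" "p \<in> sqr c s"
  shows "move_result phi_S u p (configuration 7 (vertex c s)) = (p + c) / 2"
proof -
  let ?P = "configuration 7 (vertex c s)"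
  have pair: "shape_pair ?P (tri s) (sqr c s)" using assms by (intro shape_pair_vertex) auto
  have p: "p \<in># ?P" using shape_pair_subset(4)[OF pair] assms(5) by blast
  show ?thesis
    unfolding phi_S_eq
  proof (rule move_result_halving_rule[OF covariant_square assms(4) p])
    fix X assume "\<exists>T. shape_pair ?P T X" and eq: "move_result (halving_rule (\<lambda>P S. \<exists>T. shape_pair P T S)) u p ?P
      = (p + gravity_center (mset_set X)) / 2"
    then have "X = sqr c s" using shape_pair_vertex_unique[OF assms(1-3)] by blast
    then show "move_result (halving_rule (\<lambda>P S. \<exists>T. shape_pair P T S)) u p ?P = (p + c) / 2"
      by (simp add: eq gravity_center_sqr[OF assms(1)])
  qed (use pair assms(5) in blast)
qed

lemma vertex_mem: "i < 3 \<Longrightarrow> vertex c s i \<in> tri s" "3 \<le> i \<Longrightarrow> i < 7 \<Longrightarrow> vertex c s i \<in> sqr c s"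
proof -
  assume "i < 3"
  then have "i \<in> {0, 1, 2}" by auto
  then show "vertex c s i \<in> tri s" by (auto simp: vertex_def tri_def)
next
  assume "3 \<le> i" "i < 7"
  then have "i \<in> {3, 4, 5, 6}" by auto
  then show "vertex c s i \<in> sqr c s" by (auto simp: vertex_def sqr_def)
qed

lemma vertex_half:
  "i < 3 \<Longrightarrow> vertex c (s / 2) i = vertex c s i / 2"
  "3 \<le> i \<Longrightarrow> i < 7 \<Longrightarrow> vertex c (s / 2) i = (vertex c s i + c) / 2"
proof -
  assume "i < 3"
  then have "i \<in> {0, 1, 2}" by auto
  then show "vertex c (s / 2) i = vertex c s i / 2" by (auto simp: vertex_def complex_eq_iff)
next
  assume "3 \<le> i" "i < 7"
  then have "i \<in> {3, 4, 5, 6}" by auto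
  then show "vertex c (s / 2) i = (vertex c s i + c) / 2"
    by (auto simp: vertex_def complex_eq_iff field_simps)
qed

section \<open>An execution of the mixed assignment that does not converge to a point\<close>

lemma compatible_FC1_POD:
  assumes "compatible_FC1_PO \<Phi>" "execution n \<phi> u act crash x" "fair n act"
    "card (faulty n crash) \<le> 1" "\<forall>i<n. \<phi> i \<in> \<Phi>" "2 \<le> n" "\<forall>i<n. u i \<noteq> 0"
  shows "\<exists>p. \<forall>i<n. (\<lambda>t. x t i) \<longlonglongrightarrow> p"
  using assms unfolding compatible_FC1_PO_def by blast

lemma not_compatible: "\<not> compatible_FC1_PO {phi_T, phi_S}"
proof
  assume compat: "compatible_FC1_PO {phi_T, phi_S}"
  define \<phi> where "\<phi> i = (if i < 3 then phi_T else phi_S)" for i :: nat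
  \<comment> \<open>All robots act at every step and none crashes, so both figures halve about their
    fixed centers 0 and 10.\<close>
  define x where "x t = vertex 10 ((1 / 2) ^ t)" for t :: nat
  have "x (Suc t) i = move_result (\<phi> i) 1 (x t i) (configuration 7 (x t))" if "i < 7" for t i
  proof -
    let ?s = "(1 / 2 :: real) ^ t"
    \<comment> \<open>The bound by 1 keeps the decomposition unique at every time.\<close>
    have s: "0 < ?s" "?s \<le> 1" by (auto intro: power_le_one)
    have Suc: "(1 / 2 :: real) ^ Suc t = ?s / 2" by simp
    show ?thesis
    proof (cases "i < 3")
      case True
      have "move_result phi_T 1 (x t i) (configuration 7 (x t)) = x t i / 2"
        unfolding x_def using s vertex_mem(1)[OF True] by (intro move_result_phi_T_vertex) auto
      then show ?thesis
        unfolding x_def Suc vertex_half(1)[OF True] by (simp only: \<phi>_def True if_True)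
    next
      case False
      then have i: "3 \<le> i" "i < 7" using that by auto
      have "move_result phi_S 1 (x t i) (configuration 7 (x t)) = (x t i + of_real 10) / 2"
        unfolding x_def using s vertex_mem(2)[OF i] by (intro move_result_phi_S_vertex) auto
      then show ?thesis
        unfolding x_def Suc vertex_half(2)[OF i] by (simp only: \<phi>_def False if_False)
    qed
  qed
  then have "execution 7 \<phi> (\<lambda>_. 1) (\<lambda>_. UNIV) (\<lambda>_. \<infinity>) x"
    by (simp add: execution_def)
  moreover have "fair 7 (\<lambda>_. UNIV)" "card (faulty 7 (\<lambda>_. \<infinity>)) \<le> 1" "\<forall>i<7. \<phi> i \<in> {phi_T, phi_S}"
    by (simp_all add: fair_def faulty_def \<phi>_def)
  ultimately have "\<exists>p. \<forall>i<7. (\<lambda>t. x t i) \<longlonglongrightarrow> p"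
    by (intro compatible_FC1_POD[OF compat]) auto
  \<comment> \<open>One robot of each figure: their real parts tend to 0 and to 10.\<close>
  then obtain p where p: "(\<lambda>t. Re (x t 0)) \<longlonglongrightarrow> Re p" "(\<lambda>t. Re (x t 3)) \<longlonglongrightarrow> Re p"
    using tendsto_Re by fastforce
  have "(\<lambda>t. - ((1 / 2 :: real) ^ t)) \<longlonglongrightarrow> - 0" "(\<lambda>t. 10 - (1 / 2 :: real) ^ t) \<longlonglongrightarrow> 10 - 0"
    by (intro tendsto_intros LIMSEQ_power_zero; simp)+
  then have "Re p = 0" "Re p = 10"
    using p by (simp_all add: x_def vertex_def LIMSEQ_unique)
  then show False by simp
qed

section \<open>Scale\<close>

lemma scaled_hull_1: "scaled_hull 1 P = convex hull set_mset P"
  by (simp add: scaled_hull_def)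

lemma alpha_at_le:
  assumes "0 \<le> d" "\<phi> P = Some y" "y \<in> scaled_hull d P"
  shows "alpha_at \<phi> P \<le> ennreal d"
proof -
  obtain e where e: "0 \<le> e" "y \<in> scaled_hull e P" "\<And>e'. 0 \<le> e' \<and> y \<in> scaled_hull e' P \<Longrightarrow> e \<le> e'"
    using scaled_hull_least_exists[OF assms(1,3)] by blast
  then have "(LEAST d. 0 \<le> d \<and> y \<in> scaled_hull d P) = e"
    by (intro Least_equality) auto
  then show ?thesis using assms e by (auto simp: alpha_at_def intro!: ennreal_leI)
qed

lemma alpha_at_ge:
  assumes "\<phi> P = Some y" "\<And>d. 0 \<le> d \<Longrightarrow> y \<in> scaled_hull d P \<Longrightarrow> e \<le> d"
  shows "ennreal e \<le> alpha_at \<phi> P"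
proof (cases "\<exists>d\<ge>0. y \<in> scaled_hull d P")
  case True
  then obtain d where d: "0 \<le> d" "y \<in> scaled_hull d P" "\<And>e'. 0 \<le> e' \<and> y \<in> scaled_hull e' P \<Longrightarrow> d \<le> e'"
    using scaled_hull_least_exists by blast
  then have "(LEAST d. 0 \<le> d \<and> y \<in> scaled_hull d P) = d"
    by (intro Least_equality) auto
  then show ?thesis using assms d by (auto simp: alpha_at_def intro!: ennreal_leI)
qed (use assms in \<open>auto simp: alpha_at_def\<close>)

text \<open>Both possible targets lie in the convex hull of \<open>P\<close>, which is the scaled
  hull for factor 1.\<close>

lemma alpha_halving_rule_le:
  assumes "covariant Q"
  shows "alpha (halving_rule Q) \<le> 1"
  unfolding alpha_def
proof (intro SUP_least)
  fix P :: "complex multiset" assume "P \<in> {P. P \<noteq> {#}}"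
  show "alpha_at (halving_rule Q) P \<le> 1"
  proof (cases "0 \<in># P")
    case False
    then show ?thesis by (simp add: alpha_at_def halving_rule_def)
  next
    case True
    have "\<exists>y. halving_rule Q P = Some y \<and> y \<in> convex hull set_mset P"
    proof (rule halving_rule_cases[OF assms True])
      fix X assume X: "Q P X" "0 \<in> X" and eq: "halving_rule Q P = Some (gravity_center (mset_set X) / 2)"
      then have "finite X" "X \<subseteq> set_mset P" using assms by (auto simp: covariant_def)
      \<comment> \<open>Since the origin is a vertex of \<open>X\<close>, the target is the midpoint
        of a vertex and the center.\<close>
      then have "gravity_center (mset_set X) / 2 \<in> convex hull set_mset P"
        using halfway_in_hull[of X 0] X(2) hull_mono[of X "set_mset P" convex] by (simp add: subsetD)
      then show ?thesis using eq by blast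
    next
      assume eq: "halving_rule Q P = Some (gravity_center P)"
      have "P \<noteq> {#}" using True by auto
      then show ?thesis using eq gravity_center_in_convex_hull by blast
    qed
    then obtain y where y: "halving_rule Q P = Some y" "y \<in> scaled_hull 1 P"
      unfolding scaled_hull_1 by blast
    then show ?thesis
      using alpha_at_le[of 1 "halving_rule Q" P y] by simp
  qed
qed

text \<open>Writing \<open>y\<close> as \<open>d *\<^sub>R z + (1 - d) *\<^sub>R g\<close> with
  \<open>z\<close> in the hull and projecting on \<open>w\<close> gives
  \<open>(1 - d) * K \<le> 1 / 2\<close> when \<open>d \<le> 1\<close>. As \<open>K\<close> grows,
  the lower bound on \<open>d\<close> tends to 1.\<close>

lemma alpha_at_directional:
  assumes "\<phi> P = Some y" and low: "\<And>z. z \<in># P \<Longrightarrow> 0 \<le> w \<bullet> z"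
    and y: "w \<bullet> y \<le> 1 / 2" and K: "K \<le> w \<bullet> gravity_center P" "0 < K"
  shows "ennreal (1 - 1 / (2 * K)) \<le> alpha_at \<phi> P"
proof (rule alpha_at_ge[where \<phi> = \<phi> and P = P, OF assms(1)])
  fix d :: real assume d: "0 \<le> d" "y \<in> scaled_hull d P"
  then obtain z where z: "z \<in> convex hull set_mset P" "y = d *\<^sub>R z + (1 - d) *\<^sub>R gravity_center P"
    by (auto simp: scaled_hull_def)
  have "convex hull set_mset P \<subseteq> {z. 0 \<le> w \<bullet> z}"
    using low by (intro hull_minimal) (auto intro: convex_halfspace_ge)
  then have "0 \<le> d * (w \<bullet> z)" using z d by auto
  then have *: "(1 - d) * (w \<bullet> gravity_center P) \<le> 1 / 2"
    using y unfolding z(2) by (simp add: inner_add_right)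
  show "1 - 1 / (2 * K) \<le> d"
  proof (cases "d \<le> 1")
    case True
    then have "(1 - d) * K \<le> 1 / 2"
      using * K mult_left_mono[of K "w \<bullet> gravity_center P" "1 - d"] by linarith
    then show ?thesis using K by (simp add: field_simps)
  next
    case False
    moreover have "0 \<le> 1 / (2 * K)" using K by simp
    ultimately show ?thesis by linarith
  qed
qed

lemma one_le_alpha:
  assumes "\<And>K. 1 \<le> K \<Longrightarrow> \<exists>P. P \<noteq> {#} \<and> ennreal (1 - 1 / (2 * K)) \<le> alpha_at \<phi> P"
  shows "1 \<le> alpha \<phi>"
proof (rule dense_le)
  fix e :: ennreal assume "e < 1"
  then obtain r where r: "e = ennreal r" "0 \<le> r" "r < 1"
    by (cases e) auto
  \<comment> \<open>With this \<open>K\<close> the lower bound is \<open>(1 + r) / 2\<close>, which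
    is above \<open>r\<close>.\<close>
  define K where "K = 1 / (1 - r)"
  have "1 \<le> K" "1 / (2 * K) = (1 - r) / 2" using r by (auto simp: K_def field_simps)
  then obtain P where "P \<noteq> {#}" "ennreal (1 - (1 - r) / 2) \<le> alpha_at \<phi> P"
    using assms by metis
  moreover have "e \<le> ennreal (1 - (1 - r) / 2)"
    using r by (auto intro!: ennreal_leI simp: field_simps)
  ultimately show "e \<le> alpha \<phi>"
    unfolding alpha_def by (intro SUP_upper2[of P]) auto
qed

lemma gravity_center_vertex:
  assumes "0 < s" shows "gravity_center (configuration 7 (vertex c s)) = 4 * c / 7"
  using assms sum.lessThan_Suc
  by (simp add: gravity_center_configuration vertex_def eval_nat_numeral complex_eq_iff)

text \<open>For unit length 1 and unchanged axes, local coordinates are a translation by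
  \<open>- p\<close>. A known global move thus yields the value of \<open>\<phi>\<close> at the
  local multiset.\<close>

lemma alpha_at_move_result:
  assumes \<phi>: "target_function \<phi>" and move: "move_result \<phi> 1 p C = (p + g) / 2" and p: "p \<in># C"
    and low: "\<And>q. q \<in># C \<Longrightarrow> w \<bullet> p \<le> w \<bullet> q" and g: "w \<bullet> (g - p) \<le> 1"
    and K: "K \<le> w \<bullet> (gravity_center C - p)" "0 < K"
  shows "\<exists>P. P \<noteq> {#} \<and> ennreal (1 - 1 / (2 * K)) \<le> alpha_at \<phi> P"
proof -
  define P where "P = image_mset (to_global 1 (- p)) C"
  have inv: "inv (to_global 1 p) = to_global 1 (- p)" by (simp add: inv_to_global)
  have ne: "C \<noteq> {#}" "P \<noteq> {#}" using p by (auto simp: P_def)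
  have "0 \<in># P" using p by (force simp: P_def to_global_def)
  then obtain y where y: "\<phi> P = Some y"
    using \<phi> ne(2) unfolding target_function_def by blast
  then have "p + y = (p + g) / 2"
    using move by (simp add: move_result_def inv to_global_def flip: P_def)
  then have "y = (g - p) / 2" by (simp add: field_simps)
  then have "w \<bullet> y \<le> 1 / 2" using g by (metis inner_half divide_right_mono zero_le_numeral)
  then have "ennreal (1 - 1 / (2 * K)) \<le> alpha_at \<phi> P"
    using low K gravity_center_to_global[OF ne(1), of 1 "- p"]
    by (intro alpha_at_directional[where w = w and \<phi> = \<phi> and P = P, OF y])
      (auto simp: P_def to_global_def inner_diff_right)
  then show ?thesis using ne by blast
qed

lemma set_mset_configuration_vertex:
  assumes "0 < s"
  shows "set_mset (configuration 7 (vertex c s)) = tri s \<union> sqr c s"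
  unfolding configuration_vertex[OF assms] using card_tri_sqr[OF assms] by simp

lemma one_le_alpha_phi_T: "1 \<le> alpha phi_T"
proof (rule one_le_alpha)
  fix K :: real assume K: "1 \<le> K"
  \<comment> \<open>Robot 0 is leftmost and at horizontal distance 1 from the center of the
    triangle, while the center of gravity has real part \<open>40 * K / 7\<close>.\<close>
  let ?C = "configuration 7 (vertex (10 * K) 1)" and ?p = "vertex (10 * K) 1 0"
  have p: "?p \<in> tri 1" by (rule vertex_mem) simp
  have Re_p: "Re ?p = - 1" by (simp add: vertex_def)
  show "\<exists>P. P \<noteq> {#} \<and> ennreal (1 - 1 / (2 * K)) \<le> alpha_at phi_T P"
  proof (rule alpha_at_move_result[where w = 1])
    show "move_result phi_T 1 ?p ?C = (?p + 0) / 2"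
      using move_result_phi_T_vertex[of 1 "10 * K" 1 ?p] p K by simp
    show "?p \<in># ?C" using p set_mset_configuration_vertex by auto
    show "1 \<bullet> ?p \<le> 1 \<bullet> q" if "q \<in># ?C" for q
      using that Re_tri[of q 1] Re_sqr[of q "10 * K" 1] Re_p K
      unfolding set_mset_configuration_vertex[OF zero_less_one] by (auto simp: inner_complex_def)
    show "K \<le> 1 \<bullet> (gravity_center ?C - ?p)"
      using Re_p K by (simp add: gravity_center_vertex inner_complex_def)
  qed (use K Re_p target_function_phi in \<open>simp_all add: inner_complex_def\<close>)
qed

lemma one_le_alpha_phi_S: "1 \<le> alpha phi_S"
proof (rule one_le_alpha)
  fix K :: real assume K: "1 \<le> K"
  \<comment> \<open>The mirrored choice: robot 4 is rightmost and at horizontal distance 1 from the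
    center of the square, so the direction is \<open>- 1\<close>.\<close>
  let ?C = "configuration 7 (vertex (10 * K) 1)" and ?p = "vertex (10 * K) 1 4"
  have p: "?p \<in> sqr (10 * K) 1" by (rule vertex_mem) simp_all
  have Re_p: "Re ?p = 10 * K + 1" by (simp add: vertex_def)
  show "\<exists>P. P \<noteq> {#} \<and> ennreal (1 - 1 / (2 * K)) \<le> alpha_at phi_S P"
  proof (rule alpha_at_move_result[where w = "- 1"])
    show "move_result phi_S 1 ?p ?C = (?p + 10 * K) / 2"
      using move_result_phi_S_vertex[of 1 "10 * K" 1 ?p] p K by simp
    show "?p \<in># ?C" using p set_mset_configuration_vertex by auto
    show "- 1 \<bullet> ?p \<le> - 1 \<bullet> q" if "q \<in># ?C" for q
      using that Re_tri[of q 1] Re_sqr[of q "10 * K" 1] Re_p K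
      unfolding set_mset_configuration_vertex[OF zero_less_one] by (auto simp: inner_complex_def)
    show "K \<le> - 1 \<bullet> (gravity_center ?C - ?p)"
      using Re_p K by (simp add: gravity_center_vertex inner_complex_def)
  qed (use K Re_p target_function_phi in \<open>simp_all add: inner_complex_def\<close>)
qed

theorem theorem5:
  shows "alpha_set {phi_T} = 1 \<and> alpha_set {phi_S} = 1 \<and> alpha_set ({phi_T} \<union> {phi_S}) = 1
    \<and> compatible_FC1_PO {phi_T} \<and> compatible_FC1_PO {phi_S}
    \<and> \<not> compatible_FC1_PO ({phi_T} \<union> {phi_S})"
proof -
  have "alpha phi_T = 1"
    using alpha_halving_rule_le[OF covariant_triangle] one_le_alpha_phi_T
    by (intro antisym) (simp_all add: phi_T_eq)
  moreover have "alpha phi_S = 1"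
    using alpha_halving_rule_le[OF covariant_square] one_le_alpha_phi_S
    by (intro antisym) (simp_all add: phi_S_eq)
  ultimately show ?thesis
    using compatible_phi_T compatible_phi_S not_compatible by (simp add: alpha_set_def insert_commute)
qed

end
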